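(* Fix an integer $\delta\ge1$. There is a constant $K_\delta$ such that for every $L$ the following holds on the $L\times L$ nearest-neighbour qubit lattice ($N=L^2$). Let $P$ be the set of unordered pairs $\{x,y\}$ of distinct sites with $\|x-y\|_\infty\le\delta$, and for each $\{x,y\}\in P$ let $H_{xy}$ be any Hermitian, fermion-parity-even operator in the algebra generated by $c_x,c_y,c_x^\dagger,c_y^\dagger$ (e.g. a hopping term $c_x^\dagger c_y+c_y^\dagger c_x$ or a density–density term $n_xn_y$) and $\theta_{xy}\in\mathbb R$. Then there exist canonical orderings $m_0,m_1$, an enumeration $p_1,\dots,p_{|P|}$ of $P$, and a qubit circuit $V$ consisting of at most $K_\delta N$ single-qubit gates and CNOT gates between nearest neighbours, of depth at most $K_\delta L$, such that $$V\,\Phi_{m_0}=\Phi_{m_1}\,e^{-i\theta_{p_{|P|}}H_{p_{|P|}}}\cdots e^{-i\theta_{p_1}H_{p_1}}.$$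
   Context: Qubits sit on the grid $\{0,\dots,L-1\}^2$; two-qubit gates are allowed only between sites at $\ell_1$-distance 1. There is one fermionic mode per site, with ladder operators $c_x,c_x^\dagger$ and $n_x=c_x^\dagger c_x$; fermion-parity-even means commuting with $(-1)^{n_x+n_y}$. A canonical ordering is a bijection $m$ from sites to $\{0,\dots,N-1\}$. The JW isometry $\Phi_m$ from the fermionic Fock space to the $N$-qubit space is the unique unitary with $\Phi_m|\mathrm{vac}\rangle=|0\cdots0\rangle$ and $\Phi_m c_x\Phi_m^\dagger=\tfrac12(X_x+iY_x)\prod_{y:\,m(y)<m(x)}Z_y$ for all sites $x$ (so mode $x$ is stored on qubit $x$). *)

theory Defs
  imports Complex_Main
begin

type_synonym site = "nat \<times> nat"
type_synonym cfg = "site \<Rightarrow> bool"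
  \<comment> \<open>computational basis state / occupation-number basis state\<close>
type_synonym op = "cfg \<Rightarrow> cfg \<Rightarrow> complex"
  \<comment> \<open>matrix entries: A a b = <a|A|b>\<close>

definition sites :: "nat \<Rightarrow> site set" where
  "sites L = {0..<L} \<times> {0..<L}"

definition cfgs :: "nat \<Rightarrow> cfg set" where
  "cfgs L = {s. \<forall>x. x \<notin> sites L \<longrightarrow> \<not> s x}"

definition zero_cfg :: cfg where
  "zero_cfg = (\<lambda>_. False)"

definition flip :: "cfg \<Rightarrow> site \<Rightarrow> cfg" where
  "flip b x = b(x := \<not> b x)"

definition ident :: "nat \<Rightarrow> op" where
  "ident L a b = (if a = b \<and> a \<in> cfgs L then 1 else 0)"

definition mmult :: "nat \<Rightarrow> op \<Rightarrow> op \<Rightarrow> op" where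
  "mmult L A B a b =
     (if a \<in> cfgs L \<and> b \<in> cfgs L then (\<Sum>c\<in>cfgs L. A a c * B c b) else 0)"

definition adj :: "op \<Rightarrow> op" where
  "adj A a b = cnj (A b a)"

definition wf_op :: "nat \<Rightarrow> op \<Rightarrow> bool" where
  "wf_op L A \<longleftrightarrow> (\<forall>a b. (a \<notin> cfgs L \<or> b \<notin> cfgs L) \<longrightarrow> A a b = 0)"

definition unitary_op :: "nat \<Rightarrow> op \<Rightarrow> bool" where
  "unitary_op L U \<longleftrightarrow> wf_op L U \<and> mmult L U (adj U) = ident L \<and> mmult L (adj U) U = ident L"

fun mpow :: "nat \<Rightarrow> op \<Rightarrow> nat \<Rightarrow> op" where
  "mpow L A 0 = ident L"
| "mpow L A (Suc n) = mmult L A (mpow L A n)"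

definition mexp :: "nat \<Rightarrow> op \<Rightarrow> op" where
  "mexp L A a b = (\<Sum>n. mpow L A n a b / of_nat (fact n))"

text \<open>Fock space modelled on occupation-number basis with a fixed reference
  (row-major) mode order; the statement is independent of this choice.\<close>

definition ref_ord :: "nat \<Rightarrow> site \<Rightarrow> nat" where
  "ref_ord L x = fst x * L + snd x"

definition ann :: "nat \<Rightarrow> site \<Rightarrow> op" where
  "ann L x a b =
     (if a \<in> cfgs L \<and> b \<in> cfgs L \<and> b x \<and> a = flip b x
      then (-1) ^ card {y \<in> sites L. ref_ord L y < ref_ord L x \<and> b y} else 0)"

definition parity2 :: "nat \<Rightarrow> site \<Rightarrow> site \<Rightarrow> op" where
  "parity2 L x y a b =
     (if a = b \<and> a \<in> cfgs L
      then (-1) ^ (card {z \<in> {x, y}. b z}) else 0)"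

inductive_set gen_alg :: "nat \<Rightarrow> op set \<Rightarrow> op set" for L G where
  gen: "g \<in> G \<Longrightarrow> g \<in> gen_alg L G"
| one: "ident L \<in> gen_alg L G"
| add: "A \<in> gen_alg L G \<Longrightarrow> B \<in> gen_alg L G \<Longrightarrow> (\<lambda>a b. A a b + B a b) \<in> gen_alg L G"
| smult: "A \<in> gen_alg L G \<Longrightarrow> (\<lambda>a b. z * A a b) \<in> gen_alg L G"
| mult: "A \<in> gen_alg L G \<Longrightarrow> B \<in> gen_alg L G \<Longrightarrow> mmult L A B \<in> gen_alg L G"

definition canonical_ordering :: "nat \<Rightarrow> (site \<Rightarrow> nat) \<Rightarrow> bool" where
  "canonical_ordering L m \<longleftrightarrow> bij_betw m (sites L) {0..<L * L}"

text \<open>The qubit operator (X_x + i Y_x)/2 * prod_{m y < m x} Z_y, written out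
  entrywise: (X+iY)/2 = |0><1| on qubit x, Z_y diagonal with signs (-1)^{b y}.\<close>
definition jw_image :: "nat \<Rightarrow> (site \<Rightarrow> nat) \<Rightarrow> site \<Rightarrow> op" where
  "jw_image L m x a b =
     (if a \<in> cfgs L \<and> b \<in> cfgs L \<and> b x \<and> a = flip b x
      then (-1) ^ card {y \<in> sites L. m y < m x \<and> b y} else 0)"

definition is_JW :: "nat \<Rightarrow> (site \<Rightarrow> nat) \<Rightarrow> op \<Rightarrow> bool" where
  "is_JW L m U \<longleftrightarrow> unitary_op L U
     \<and> (\<forall>a. U a zero_cfg = (if a = zero_cfg then 1 else 0))
     \<and> (\<forall>x \<in> sites L. mmult L (mmult L U (ann L x)) (adj U) = jw_image L m x)"

definition Phi :: "nat \<Rightarrow> (site \<Rightarrow> nat) \<Rightarrow> op" where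
  "Phi L m = (THE U. is_JW L m U)"

datatype gate = Single site "bool \<Rightarrow> bool \<Rightarrow> complex" | CNOT site site

definition unitary2 :: "(bool \<Rightarrow> bool \<Rightarrow> complex) \<Rightarrow> bool" where
  "unitary2 u \<longleftrightarrow> (\<forall>i j. (\<Sum>k\<in>UNIV. u i k * cnj (u j k)) = (if i = j then 1 else 0))"

definition l1_adjacent :: "site \<Rightarrow> site \<Rightarrow> bool" where
  "l1_adjacent x y \<longleftrightarrow>
     nat \<bar>int (fst x) - int (fst y)\<bar> + nat \<bar>int (snd x) - int (snd y)\<bar> = 1"

fun gate_ok :: "nat \<Rightarrow> gate \<Rightarrow> bool" where
  "gate_ok L (Single q u) \<longleftrightarrow> q \<in> sites L \<and> unitary2 u"
| "gate_ok L (CNOT c t) \<longleftrightarrow> c \<in> sites L \<and> t \<in> sites L \<and> l1_adjacent c t"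

fun gate_qubits :: "gate \<Rightarrow> site list" where
  "gate_qubits (Single q u) = [q]"
| "gate_qubits (CNOT c t) = [c, t]"

fun gate_op :: "nat \<Rightarrow> gate \<Rightarrow> op" where
  "gate_op L (Single q u) a b =
     (if a \<in> cfgs L \<and> b \<in> cfgs L \<and> (\<forall>y. y \<noteq> q \<longrightarrow> a y = b y) then u (a q) (b q) else 0)"
| "gate_op L (CNOT c t) a b =
     (if a \<in> cfgs L \<and> b \<in> cfgs L \<and> a = (if b c then flip b t else b) then 1 else 0)"

text \<open>A circuit is a list of layers; each layer is a list of gates acting on
  pairwise disjoint qubits. Depth = number of layers. Gates are applied in list
  order (first gate first).\<close>
type_synonym circuit = "gate list list"

definition circuit_ok :: "nat \<Rightarrow> circuit \<Rightarrow> bool" where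
  "circuit_ok L C \<longleftrightarrow> (\<forall>layer \<in> set C. (\<forall>g \<in> set layer. gate_ok L g)
                         \<and> distinct (concat (map gate_qubits layer)))"

definition gate_count :: "circuit \<Rightarrow> nat" where
  "gate_count C = length (concat C)"

definition depth :: "circuit \<Rightarrow> nat" where
  "depth C = length C"

definition circuit_op :: "nat \<Rightarrow> circuit \<Rightarrow> op" where
  "circuit_op L C = foldl (\<lambda>acc g. mmult L (gate_op L g) acc) (ident L) (concat C)"

definition linf_dist :: "site \<Rightarrow> site \<Rightarrow> nat" where
  "linf_dist x y = max (nat \<bar>int (fst x) - int (fst y)\<bar>) (nat \<bar>int (snd x) - int (snd y)\<bar>)"

definition pairs :: "nat \<Rightarrow> nat \<Rightarrow> site set set" where
  "pairs L \<delta> = {{x, y} | x y. x \<in> sites L \<and> y \<in> sites L \<and> x \<noteq> y \<and> linf_dist x y \<le> \<delta>}"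

definition evo :: "nat \<Rightarrow> op \<Rightarrow> real \<Rightarrow> op" where
  "evo L H \<theta> = mexp L (\<lambda>a b. - (\<i> * of_real \<theta>) * H a b)"

definition evo_product :: "nat \<Rightarrow> (site set \<Rightarrow> op) \<Rightarrow> (site set \<Rightarrow> real) \<Rightarrow> site set list \<Rightarrow> op" where
  "evo_product L H \<theta> ps = foldl (\<lambda>acc p. mmult L (evo L (H p) (\<theta> p)) acc) (ident L) ps"

definition admissible_term :: "nat \<Rightarrow> site \<Rightarrow> site \<Rightarrow> op \<Rightarrow> bool" where
  "admissible_term L x y H \<longleftrightarrow>
     H \<in> gen_alg L {ann L x, ann L y, adj (ann L x), adj (ann L y)}
     \<and> adj H = H
     \<and> mmult L H (parity2 L x y) = mmult L (parity2 L x y) H"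

end

(*
The Fock basis is taken with the row-major Jordan-Wigner order, for which Phi is the identity, so
m0 = m1 = row-major works and the product of evolutions itself has to be compiled.

Cut the lattice into horizontal strips of height 2 delta, once with offset 0 and once with offset
delta; every pair lies in a strip of one of the two families. Inside a strip, reorder the modes
from row-major to column-major. This is the diagonal sign (-1)^q with q the sum of b(u) b(v) over
u = (i,c), v = (i',c') with i < i' and c > c'. Sweeping once over the columns while the CNOTs
(i,j+1) -> (i,j) accumulate row-suffix parities makes every contribution to q local, so the
reordering costs O(L) gates for each strip.
In column-major order two modes x, y at distance at most delta have only O(1) modes between them;
O(1) controlled-Z gates make them consecutive, and then a parity-even H_xy is a two-qubit operator.
Conjugating with CNOT from x to y turns it into a single-qubit operator on x multiplexed by y,
whose exponential is compiled by diagonalising two Hermitian 2x2 matrices.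
All O(L) gates of a strip run sequentially, the disjoint strips of a family in parallel.
*)
theory Submission
  imports Defs
begin

text \<open>In row-major order the string between two vertical neighbours covers about L modes, so
  compiling each of the O(N) evolutions separately would cost of the order N^(3/2) gates. Reordering
  a strip also costs O(L), hence it must be shared: the reordering sign squares to one, so the
  conjugated evolutions of a strip telescope and only one reordering before and one after all of
  them remain. The grouping by strips is possible because the enumeration of the pairs may be
  chosen; evolutions are never exchanged.

  No reordering across strips is needed. Rows before the strip precede its modes in both orders and
  rows after it never do, so the outside modes contribute one common sign. That sign occurs only in
  the odd entries of an operator on two modes, and evenness removes these.

  The shift by \<delta> works because a pair spans at most \<delta> + 1 rows: if it starts in the
  first half of a block of 2 \<delta> rows it stays in that block, otherwise it fits into a shifted
  one.\<close>

declare split_paired_All [simp del] split_paired_Ex [simp del]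

section \<open>Matrix algebra over the finite set of configurations\<close>

lemma finite_sites [simp]: "finite (sites L)"
  by (simp add: sites_def)

lemma finite_cfgs [simp]: "finite (cfgs L)"
proof -
  have "cfgs L \<subseteq> (\<lambda>A x. x \<in> A) ` Pow (sites L)"
  proof
    fix s assume "s \<in> cfgs L"
    then have "{x. s x} \<in> Pow (sites L)" by (auto simp: cfgs_def)
    moreover have "s = (\<lambda>x. x \<in> {x. s x})" by simp
    ultimately show "s \<in> (\<lambda>A x. x \<in> A) ` Pow (sites L)" by blast
  qed
  then show ?thesis by (rule finite_subset) simp
qed

lemma flip_in_cfgs [simp]: "b \<in> cfgs L \<Longrightarrow> x \<in> sites L \<Longrightarrow> flip b x \<in> cfgs L"
  by (auto simp: cfgs_def flip_def)

lemma upd_in_cfgs [simp]: "b \<in> cfgs L \<Longrightarrow> x \<in> sites L \<Longrightarrow> b(x := i) \<in> cfgs L"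
  by (auto simp: cfgs_def)

lemma flip_flip [simp]: "flip (flip b x) x = b"
  by (auto simp: flip_def)

lemma flip_apply: "flip b x z = (if z = x then \<not> b x else b z)"
  by (simp add: flip_def)

lemma zero_in_cfgs [simp]: "zero_cfg \<in> cfgs L"
  by (simp add: cfgs_def zero_cfg_def)

lemma wf_mmult [simp]: "wf_op L (mmult L A B)"
  by (auto simp: wf_op_def mmult_def)

lemma wf_ident [simp]: "wf_op L (ident L)"
  by (auto simp: wf_op_def ident_def)

lemma wf_op_eqI:
  assumes "wf_op L A" "wf_op L B"
    and "\<And>a b. a \<in> cfgs L \<Longrightarrow> b \<in> cfgs L \<Longrightarrow> A a b = B a b"
  shows "A = B"
proof (intro ext)
  fix a b show "A a b = B a b"
    using assms by (cases "a \<in> cfgs L \<and> b \<in> cfgs L") (auto simp: wf_op_def)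
qed

lemma mmult_apply:
  "a \<in> cfgs L \<Longrightarrow> b \<in> cfgs L \<Longrightarrow> mmult L A B a b = (\<Sum>c\<in>cfgs L. A a c * B c b)"
  by (simp add: mmult_def)

lemma mmult_assoc: "mmult L (mmult L A B) C = mmult L A (mmult L B C)"
proof (rule wf_op_eqI)
  fix a b assume ab: "a \<in> cfgs L" "b \<in> cfgs L"
  have "mmult L (mmult L A B) C a b = (\<Sum>c\<in>cfgs L. \<Sum>e\<in>cfgs L. A a e * (B e c * C c b))"
    using ab by (simp add: mmult_apply sum_distrib_right mult.assoc)
  also have "\<dots> = (\<Sum>e\<in>cfgs L. \<Sum>c\<in>cfgs L. A a e * (B e c * C c b))"
    by (rule sum.swap)
  also have "\<dots> = mmult L A (mmult L B C) a b"
    using ab by (simp add: mmult_apply sum_distrib_left)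
  finally show "mmult L (mmult L A B) C a b = mmult L A (mmult L B C) a b" .
qed simp_all

lemma mmult_ident_left [simp]: "wf_op L A \<Longrightarrow> mmult L (ident L) A = A"
  by (rule wf_op_eqI) (auto simp: mmult_apply ident_def if_distribR if_distrib cong: if_cong)

lemma mmult_ident_right [simp]: "wf_op L A \<Longrightarrow> mmult L A (ident L) = A"
  by (rule wf_op_eqI) (auto simp: mmult_apply ident_def if_distrib cong: if_cong conj_cong)

lemma adj_mmult: "adj (mmult L A B) = mmult L (adj B) (adj A)"
  by (auto simp: adj_def mmult_def fun_eq_iff mult.commute)

lemma adj_adj [simp]: "adj (adj A) = A"
  by (simp add: adj_def fun_eq_iff)

lemma wf_adj [simp]: "wf_op L (adj A) = wf_op L A"
  by (auto simp: wf_op_def adj_def)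

lemma wf_ann [simp]: "wf_op L (ann L x)"
  by (auto simp: wf_op_def ann_def)

lemma adj_ident [simp]: "adj (ident L) = ident L"
  by (intro ext) (auto simp: adj_def ident_def)

subsection \<open>The Jordan-Wigner isometry of the row-major ordering\<close>

text \<open>For \<open>ref_ord\<close> the operator \<open>jw_image\<close> is \<open>ann\<close>
  itself, so the Jordan-Wigner relation says that \<open>U\<close> commutes with annihilators up to
  unitarity. The adjoint form, for creation operators, is what builds up basis states from the
  vacuum.\<close>

lemma JW_ref_commutes:
  assumes "is_JW L (ref_ord L) U" "x \<in> sites L"
  shows "mmult L U (adj (ann L x)) = mmult L (adj (ann L x)) U"
proof -
  let ?A = "ann L x"
  have jw: "jw_image L (ref_ord L) x = ?A"
    by (simp add: jw_image_def ann_def fun_eq_iff)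
  have U: "mmult L U (adj U) = ident L" "mmult L (adj U) U = ident L" "wf_op L U"
    and c: "mmult L (mmult L U ?A) (adj U) = ?A"
    using assms jw by (auto simp: is_JW_def unitary_op_def)
  have "mmult L (adj U) ?A = mmult L (adj U) (mmult L (mmult L U ?A) (adj U))"
    using c by simp
  also have "\<dots> = mmult L (mmult L (mmult L (adj U) U) ?A) (adj U)"
    by (simp only: mmult_assoc)
  also have "\<dots> = mmult L ?A (adj U)"
    using U by simp
  finally have "adj (mmult L (adj U) ?A) = adj (mmult L ?A (adj U))" by simp
  then show ?thesis by (simp add: adj_mmult)
qed

text \<open>\<open>U\<close> fixes the vacuum and commutes with the creation operators, and these
  generate every basis state up to sign. The induction is on the number of occupied sites.\<close>

lemma JW_ref_unique:
  assumes "is_JW L (ref_ord L) U"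
  shows "U = ident L"
proof (rule wf_op_eqI)
  show "wf_op L U" using assms by (auto simp: is_JW_def unitary_op_def)
  fix a b assume ab: "a \<in> cfgs L" "b \<in> cfgs L"
  have "\<forall>a\<in>cfgs L. U a b = ident L a b"
    using ab(2)
  proof (induction "card {z. b z}" arbitrary: b)
    case 0
    have "finite {z. b z}"
      using 0 by (auto intro!: finite_subset[OF _ finite_sites[of L]] simp: cfgs_def)
    with 0 have "b = zero_cfg" by (auto simp: zero_cfg_def)
    with 0 assms show ?case by (auto simp: is_JW_def ident_def)
  next
    case (Suc n)
    then obtain x where x: "b x" by (metis card.empty empty_Collect_eq nat.distinct(1))
    have xs: "x \<in> sites L" using x Suc.prems by (auto simp: cfgs_def)
    define c where "c = flip b x"
    have c: "c \<in> cfgs L" "b = flip c x" "\<not> c x"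
      using x xs Suc.prems by (auto simp: c_def flip_apply)
    have "{z. b z} = insert x {z. c z}" "x \<notin> {z. c z}"
      using x by (auto simp: c_def flip_apply)
    moreover have "finite {z. c z}"
      using c by (auto intro!: finite_subset[OF _ finite_sites[of L]] simp: cfgs_def)
    ultimately have "n = card {z. c z}" using Suc.hyps(2) by simp
    from Suc.hyps(1)[OF this c(1)] have IH: "\<forall>a\<in>cfgs L. U a c = ident L a c" .
    define A where "A = adj (ann L x)"
    \<comment> \<open>Creating a fermion at \<open>x\<close> sends \<open>c\<close> to
      \<open>b\<close> times the sign \<sigma>, so column \<open>c\<close> of \<open>A\<close> has a
      single nonzero entry. Comparing column \<open>c\<close> of \<open>U A\<close> and
      \<open>A U\<close> then determines column \<open>b\<close> of \<open>U\<close>.\<close>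
    obtain \<sigma> where \<sigma>: "\<sigma> \<noteq> 0" "\<And>e. A e c = (if e = b then \<sigma> else 0)"
    proof
      show "(-1) ^ card {y \<in> sites L. ref_ord L y < ref_ord L x \<and> b y} \<noteq> (0::complex)" by simp
      show "A e c = (if e = b then (-1) ^ card {y \<in> sites L. ref_ord L y < ref_ord L x \<and> b y} else 0)" for e
      proof -
        have "e x \<and> c = flip e x \<longleftrightarrow> e = b"
          using x c(2) c_def flip_flip[of e x] by metis
        then show ?thesis
          using c(1) Suc.prems by (auto simp: A_def adj_def ann_def)
      qed
    qed
    show ?case
    proof
      fix a assume a: "a \<in> cfgs L"
      have "U a b * \<sigma> = mmult L U A a c"
        using a c Suc.prems by (simp add: mmult_apply \<sigma> if_distrib cong: if_cong)
      also have "\<dots> = mmult L A U a c"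
        using JW_ref_commutes[OF assms xs] by (simp add: A_def)
      also have "\<dots> = (\<Sum>e\<in>cfgs L. if e = c then A a c else 0)"
        unfolding mmult_apply[OF a c(1)]
        by (rule sum.cong[OF refl]) (use IH in \<open>auto simp: ident_def\<close>)
      also have "\<dots> = A a c" using c by simp
      also have "\<dots> = ident L a b * \<sigma>" using \<sigma> a by (simp add: ident_def)
      finally show "U a b = ident L a b" using \<sigma>(1) by simp
    qed
  qed
  then show "U a b = ident L a b" using ab by blast
qed simp

text \<open>\<open>Phi\<close> is a definite description, so its value is accessible only through
  existence together with uniqueness.\<close>

lemma Phi_ref_ord: "Phi L (ref_ord L) = ident L"
  unfolding Phi_def
proof (rule the_equality)
  show "is_JW L (ref_ord L) (ident L)"
  proof -
    have "jw_image L (ref_ord L) x = ann L x" for x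
      by (intro ext) (simp add: jw_image_def ann_def)
    then show ?thesis
      by (simp add: is_JW_def unitary_op_def) (simp add: ident_def)
  qed
qed (rule JW_ref_unique)

lemma canonical_ordering_ref_ord: "canonical_ordering L (ref_ord L)"
  unfolding canonical_ordering_def
proof (rule bij_betwI')
  have "x = (ref_ord L x div L, ref_ord L x mod L)" if "x \<in> sites L" for x
    using that by (cases x) (auto simp: sites_def ref_ord_def)
  then show "(ref_ord L x = ref_ord L y) = (x = y)" if "x \<in> sites L" "y \<in> sites L" for x y
    using that by metis
next
  fix x assume "x \<in> sites L"
  then have x: "fst x < L" "snd x < L" by (auto simp: sites_def)
  then have "(fst x + 1) * L \<le> L * L" by (intro mult_right_mono) auto
  then have "fst x * L + snd x < L * L" using x by simp
  then show "ref_ord L x \<in> {0..<L * L}"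
    by (simp add: ref_ord_def)
next
  fix n assume n: "n \<in> {0..<L * L}"
  then have "L > 0" by (cases L) auto
  then show "\<exists>x\<in>sites L. n = ref_ord L x"
    using n by (intro bexI[of _ "(n div L, n mod L)"])
      (auto simp: sites_def ref_ord_def less_mult_imp_div_less)
qed

subsection \<open>Monomial operators\<close>

text \<open>Generalised permutation matrices. Diagonal gates and CNOTs have this shape, so products
  of them reduce to composing functions on configurations and multiplying phases, without
  sums.\<close>

definition monomial :: "nat \<Rightarrow> (cfg \<Rightarrow> cfg) \<Rightarrow> (cfg \<Rightarrow> complex) \<Rightarrow> op" where
  "monomial L f \<phi> a b = (if b \<in> cfgs L \<and> a = f b then \<phi> b else 0)"

lemma wf_monomial:
  "(\<And>b. b \<in> cfgs L \<Longrightarrow> f b \<in> cfgs L) \<Longrightarrow> wf_op L (monomial L f \<phi>)"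
  by (auto simp: wf_op_def monomial_def)

lemma wf_diagonal [simp]: "wf_op L (monomial L (\<lambda>b. b) \<phi>)"
  by (rule wf_monomial)

lemma monomial_cong:
  "(\<And>b. b \<in> cfgs L \<Longrightarrow> f b = g b \<and> \<phi> b = \<psi> b) \<Longrightarrow> monomial L f \<phi> = monomial L g \<psi>"
  by (intro ext) (auto simp: monomial_def)

lemma ident_eq_monomial: "ident L = monomial L (\<lambda>b. b) (\<lambda>_. 1)"
  by (intro ext) (auto simp: ident_def monomial_def)

lemma mmult_monomial_right:
  assumes "a \<in> cfgs L" "b \<in> cfgs L" "f b \<in> cfgs L"
  shows "mmult L A (monomial L f \<phi>) a b = A a (f b) * \<phi> b"
  using assms by (simp add: mmult_apply monomial_def if_distrib cong: if_cong)

lemma mmult_monomial: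
  assumes "\<And>b. b \<in> cfgs L \<Longrightarrow> f b \<in> cfgs L" "\<And>b. b \<in> cfgs L \<Longrightarrow> g b \<in> cfgs L"
  shows "mmult L (monomial L f \<phi>) (monomial L g \<psi>) = monomial L (\<lambda>b. f (g b)) (\<lambda>b. \<phi> (g b) * \<psi> b)"
proof (rule wf_op_eqI)
  fix a b assume "a \<in> cfgs L" "b \<in> cfgs L"
  then show "mmult L (monomial L f \<phi>) (monomial L g \<psi>) a b
      = monomial L (\<lambda>b. f (g b)) (\<lambda>b. \<phi> (g b) * \<psi> b) a b"
    using assms by (simp add: mmult_monomial_right) (simp add: monomial_def)
qed (use assms in \<open>auto intro: wf_monomial\<close>)

lemma mmult_diagonal_left:
  assumes "a \<in> cfgs L" "b \<in> cfgs L"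
  shows "mmult L (monomial L (\<lambda>b. b) \<phi>) A a b = \<phi> a * A a b"
proof -
  have "monomial L (\<lambda>b. b) \<phi> a c * A c b = (if c = a then \<phi> a * A a b else 0)" if "c \<in> cfgs L" for c
    using assms that by (auto simp: monomial_def)
  then show ?thesis using assms by (simp add: mmult_apply)
qed

text \<open>Row \<open>a\<close> has its entries at the preimages of \<open>a\<close> under
  \<open>f\<close>; for an involution the only one is \<open>f a\<close>.\<close>

lemma mmult_involution_left:
  assumes "a \<in> cfgs L" "b \<in> cfgs L"
    "\<And>b. b \<in> cfgs L \<Longrightarrow> f b \<in> cfgs L" "\<And>b. b \<in> cfgs L \<Longrightarrow> f (f b) = b"
  shows "mmult L (monomial L f (\<lambda>_. 1)) A a b = A (f a) b"
proof -
  have "monomial L f (\<lambda>_. 1) a c * A c b = (if c = f a then A (f a) b else 0)" if "c \<in> cfgs L" for c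
    using assms that by (auto simp: monomial_def)
  then show ?thesis using assms by (simp add: mmult_apply)
qed

subsection \<open>Gate lists\<close>

definition gates_op :: "nat \<Rightarrow> gate list \<Rightarrow> op" where
  "gates_op L gs = foldl (\<lambda>acc g. mmult L (gate_op L g) acc) (ident L) gs"

lemma foldl_mmult:
  assumes "wf_op L X"
  shows "foldl (\<lambda>acc g. mmult L (f g) acc) X gs
      = mmult L (foldl (\<lambda>acc g. mmult L (f g) acc) (ident L) gs) X"
proof (induction gs rule: rev_induct)
  case Nil
  then show ?case using assms by simp
next
  case (snoc g gs)
  then show ?case by (simp add: mmult_assoc)
qed

lemma wf_foldl_mmult [simp]: "wf_op L (foldl (\<lambda>acc g. mmult L (f g) acc) (ident L) gs)"
  by (induction gs rule: rev_induct) auto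

lemma wf_gates_op [simp]: "wf_op L (gates_op L gs)"
  by (simp add: gates_op_def)

lemma wf_gate_op [simp]: "gate_ok L g \<Longrightarrow> wf_op L (gate_op L g)"
  by (cases g) (auto simp: wf_op_def)

lemma gates_op_Nil [simp]: "gates_op L [] = ident L"
  by (simp add: gates_op_def)

lemma gates_op_append: "gates_op L (gs @ hs) = mmult L (gates_op L hs) (gates_op L gs)"
  unfolding gates_op_def foldl_append by (rule foldl_mmult) simp

lemma gates_op_single: "gate_ok L g \<Longrightarrow> gates_op L [g] = gate_op L g"
  by (simp add: gates_op_def)

lemma evo_product_append:
  "evo_product L H \<theta> (ps @ qs) = mmult L (evo_product L H \<theta> qs) (evo_product L H \<theta> ps)"
  unfolding evo_product_def foldl_append by (rule foldl_mmult) simp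

lemma wf_evo_product [simp]: "wf_op L (evo_product L H \<theta> ps)"
  by (simp add: evo_product_def)

text \<open>Layers are ignored here because the gates of a strip run one after another. The support
  \<open>S\<close> is recorded so that strips can be run in parallel later.\<close>

definition gates_impl :: "nat \<Rightarrow> site set \<Rightarrow> nat \<Rightarrow> op \<Rightarrow> bool" where
  "gates_impl L S n U \<longleftrightarrow> (\<exists>gs. (\<forall>g\<in>set gs. gate_ok L g \<and> set (gate_qubits g) \<subseteq> S)
      \<and> length gs \<le> n \<and> gates_op L gs = U)"

lemma gates_impl_mono: "gates_impl L S n U \<Longrightarrow> n \<le> m \<Longrightarrow> gates_impl L S m U"
  unfolding gates_impl_def by (elim exE conjE, rule exI) auto

lemma gates_impl_ident: "gates_impl L S 0 (ident L)"
  unfolding gates_impl_def by (rule exI[of _ "[]"]) simp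

lemma gates_impl_mmult:
  "gates_impl L S n U \<Longrightarrow> gates_impl L S m V \<Longrightarrow> gates_impl L S (n + m) (mmult L V U)"
  unfolding gates_impl_def
proof (elim exE conjE)
  fix gs hs
  assume "\<forall>g\<in>set gs. gate_ok L g \<and> set (gate_qubits g) \<subseteq> S" "length gs \<le> n" "gates_op L gs = U"
    "\<forall>g\<in>set hs. gate_ok L g \<and> set (gate_qubits g) \<subseteq> S" "length hs \<le> m" "gates_op L hs = V"
  then show "\<exists>gs. (\<forall>g\<in>set gs. gate_ok L g \<and> set (gate_qubits g) \<subseteq> S)
      \<and> length gs \<le> n + m \<and> gates_op L gs = mmult L V U"
    by (intro exI[of _ "gs @ hs"]) (auto simp: gates_op_append)
qed

lemma gates_impl_gate:
  "gate_ok L g \<Longrightarrow> set (gate_qubits g) \<subseteq> S \<Longrightarrow> gates_impl L S 1 (gate_op L g)"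
  unfolding gates_impl_def by (rule exI[of _ "[g]"]) (auto simp: gates_op_single)

lemma sum_bool: "(\<Sum>i\<in>UNIV. f i) = f False + f (True :: bool)"
  by (simp add: UNIV_bool)

subsection \<open>Two-qubit primitives\<close>

text \<open>Cutting the rows off at \<open>L\<close> keeps every strip inside the lattice without a
  condition on \<open>hi\<close>.\<close>

definition strip :: "nat \<Rightarrow> nat \<Rightarrow> nat \<Rightarrow> site set" where
  "strip L lo hi = {lo..<min L hi} \<times> {0..<L}"

lemma strip_subset [simp]: "strip L lo hi \<subseteq> sites L"
  by (auto simp: strip_def sites_def)

lemma strip_sites: "x \<in> strip L lo hi \<Longrightarrow> x \<in> sites L"
  using strip_subset by blast

lemma finite_strip [simp]: "finite (strip L lo hi)"
  by (simp add: strip_def)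

definition cnot :: "site \<Rightarrow> site \<Rightarrow> cfg \<Rightarrow> cfg" where
  "cnot c t b = (if b c then flip b t else b)"

definition cnot_op :: "nat \<Rightarrow> site \<Rightarrow> site \<Rightarrow> op" where
  "cnot_op L c t = monomial L (cnot c t) (\<lambda>_. 1)"

lemma cnot_in_cfgs [simp]: "b \<in> cfgs L \<Longrightarrow> t \<in> sites L \<Longrightarrow> cnot c t b \<in> cfgs L"
  by (simp add: cnot_def)

lemma cnot_apply: "cnot c t b z = (if z = t then b t \<noteq> b c else b z)"
  by (simp add: cnot_def flip_def)

lemma cnot_cnot: "c \<noteq> t \<Longrightarrow> cnot c t (cnot c t b) = b"
  by (rule ext) (auto simp: cnot_apply)

definition l1_dist :: "site \<Rightarrow> site \<Rightarrow> nat" where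
  "l1_dist x y = nat \<bar>int (fst x) - int (fst y)\<bar> + nat \<bar>int (snd x) - int (snd y)\<bar>"

text \<open>One step from \<open>t\<close> towards \<open>c\<close>, along the rows as long as these
  differ and then along the columns. The moved coordinate stays between those of \<open>c\<close>
  and \<open>t\<close>, so a rectangular strip is not left.\<close>

lemma closer_neighbour:
  assumes "c \<in> strip L lo hi" "t \<in> strip L lo hi" "l1_dist c t \<ge> 2"
  obtains v where "v \<in> strip L lo hi" "l1_dist c v < l1_dist c t" "l1_adjacent v t" "v \<noteq> c" "v \<noteq> t"
proof -
  obtain c1 c2 t1 t2 where [simp]: "c = (c1, c2)" "t = (t1, t2)" by fastforce
  define v where "v = (if c1 < t1 then (t1 - 1, t2) else if t1 < c1 then (t1 + 1, t2)
    else if c2 < t2 then (t1, t2 - 1) else (t1, t2 + 1))"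
  have "v \<in> strip L lo hi" "l1_dist c v < l1_dist c t" "l1_adjacent v t" "v \<noteq> c" "v \<noteq> t"
    using assms by (auto simp: v_def strip_def l1_dist_def l1_adjacent_def split: if_splits)
  then show ?thesis by (rule that)
qed

text \<open>A CNOT from \<open>c\<close> to \<open>t\<close> is the commutator of the CNOTs from
  \<open>c\<close> to \<open>v\<close> and from \<open>v\<close> to \<open>t\<close>: the value of
  \<open>v\<close> cancels in \<open>t\<close>, and \<open>v\<close> itself is restored. Each unit
  of distance doubles the cost and adds 2, which \<open>4 ^ n\<close> dominates; this is affordable
  since only distances bounded in terms of \<delta> occur.\<close>

lemma cnot_op_impl:
  assumes "c \<in> strip L lo hi" "t \<in> strip L lo hi" "c \<noteq> t" "l1_dist c t \<le> n"
  shows "gates_impl L (strip L lo hi) (4 ^ n) (cnot_op L c t)"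
  using assms
proof (induction n arbitrary: t)
  case 0
  then show ?case by (cases c; cases t) (auto simp: l1_dist_def)
next
  case (Suc n)
  have gate: "gates_impl L (strip L lo hi) 1 (cnot_op L u v)"
    if "u \<in> strip L lo hi" "v \<in> strip L lo hi" "l1_adjacent u v" for u v
  proof -
    have "cnot_op L u v = gate_op L (CNOT u v)"
      using that by (intro ext) (auto simp: cnot_op_def monomial_def cnot_def strip_sites)
    then show ?thesis
      using gates_impl_gate[of L "CNOT u v"] that by (auto simp: strip_sites)
  qed
  show ?case
  proof (cases "l1_adjacent c t")
    case True
    then show ?thesis using gate[of c t] Suc.prems gates_impl_mono by fastforce
  next
    case False
    have "l1_dist c t \<noteq> 0" using Suc.prems(3) by (cases c; cases t) (auto simp: l1_dist_def)
    moreover have "l1_dist c t \<noteq> 1" using False by (simp add: l1_dist_def l1_adjacent_def)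
    ultimately have "l1_dist c t \<ge> 2" by simp
    then obtain v where v: "v \<in> strip L lo hi" "l1_dist c v < l1_dist c t" "l1_adjacent v t"
      "v \<noteq> c" "v \<noteq> t"
      using closer_neighbour[OF Suc.prems(1,2)] by metis
    have cv: "gates_impl L (strip L lo hi) (4 ^ n) (cnot_op L c v)"
      using Suc.IH[of v] v Suc.prems by auto
    note vt = gate[OF v(1) Suc.prems(2) v(3)]
    have "monomial L (\<lambda>b. cnot v t (cnot c v (cnot v t (cnot c v b)))) (\<lambda>_. 1) = cnot_op L c t"
      unfolding cnot_op_def
    proof (rule monomial_cong, intro conjI ext)
      fix b z show "cnot v t (cnot c v (cnot v t (cnot c v b))) z = cnot c t b z"
        using v Suc.prems(3) by (auto simp: cnot_apply)
    qed simp
    then have "mmult L (cnot_op L v t) (mmult L (cnot_op L c v) (mmult L (cnot_op L v t) (cnot_op L c v)))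
        = cnot_op L c t"
      using v(1) Suc.prems(2) by (simp add: cnot_op_def mmult_monomial strip_sites)
    moreover note gates_impl_mmult[OF gates_impl_mmult[OF gates_impl_mmult[OF cv vt] cv] vt]
    moreover have "4 ^ n + 1 + 4 ^ n + 1 \<le> (4::nat) ^ Suc n"
      using one_le_power[of "4::nat" n] by simp
    ultimately show ?thesis using gates_impl_mono by simp
  qed
qed

lemma single_diagonal_impl:
  assumes "q \<in> S" "q \<in> sites L" "\<And>i. norm (f i) = 1"
  shows "gates_impl L S 1 (monomial L (\<lambda>b. b) (\<lambda>b. f (b q)))"
proof -
  let ?u = "\<lambda>i j. if i = j then f i else 0"
  have "f i * cnj (f i) = 1" for i
    using assms(3)[of i] by (simp add: complex_norm_square[symmetric])
  then have "unitary2 ?u"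
    by (auto simp: unitary2_def sum_bool)
  moreover have "gate_op L (Single q ?u) = monomial L (\<lambda>b. b) (\<lambda>b. f (b q))"
  proof (intro ext)
    fix a b :: cfg
    have "a = b \<longleftrightarrow> (\<forall>y. y \<noteq> q \<longrightarrow> a y = b y) \<and> a q = b q" by auto
    then show "gate_op L (Single q ?u) a b = monomial L (\<lambda>b. b) (\<lambda>b. f (b q)) a b"
      by (auto simp: monomial_def)
  qed
  ultimately show ?thesis
    using gates_impl_gate[of L "Single q ?u" S] assms by simp
qed

text \<open>Every phase function of two bits is a sum of a function of the first bit, a multiple of
  the second, and a multiple of their exclusive or. The last part is a one-qubit phase on
  \<open>t\<close> conjugated by a CNOT, which gives three one-qubit gates and two CNOTs.\<close>

lemma phase2_impl:
  assumes "c \<in> strip L lo hi" "t \<in> strip L lo hi" "c \<noteq> t" "l1_dist c t \<le> n"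
    and "\<And>i j. norm (f i j) = 1"
  shows "gates_impl L (strip L lo hi) (3 + 2 * 4 ^ n) (monomial L (\<lambda>b. b) (\<lambda>b. f (b c) (b t)))"
proof -
  have "\<exists>\<phi>. f i j = cis \<phi>" for i j
  proof
    have "f i j \<noteq> 0" using assms(5)[of i j] by auto
    then show "f i j = cis (Arg (f i j))"
      using assms(5)[of i j] by (simp add: cis_Arg sgn_eq)
  qed
  then obtain F where F: "\<And>i j. f i j = cis (F i j)" by metis
  \<comment> \<open>For control value 0 the values of \<open>F\<close> differ by \<beta> + \<gamma>,
    and for control value 1 by \<gamma> - \<beta>; both are solved for \<beta> and \<gamma>.\<close>
  define \<gamma> where "\<gamma> = ((F False True - F False False) + (F True False - F True True)) / 2"
  define \<beta> where "\<beta> = ((F False True - F False False) - (F True False - F True True)) / 2"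
  define \<alpha> where "\<alpha> i = (if i then F True False - \<gamma> else F False False)" for i
  have F_eq: "F i j = \<alpha> i + (if j then \<beta> else 0) + (if i \<noteq> j then \<gamma> else 0)" for i j
    by (cases i; cases j) (auto simp: \<alpha>_def \<beta>_def \<gamma>_def field_simps)
  let ?D = "\<lambda>\<phi>. monomial L (\<lambda>b. b) \<phi>"
  let ?A = "?D (\<lambda>b. cis (\<alpha> (b c)))" and ?B = "?D (\<lambda>b. cis (if b t then \<beta> else 0))"
    and ?C = "?D (\<lambda>b. cis (if b t then \<gamma> else 0))" and ?X = "cnot_op L c t"
  have A: "gates_impl L (strip L lo hi) 1 ?A"
    and B: "gates_impl L (strip L lo hi) 1 ?B"
    and C: "gates_impl L (strip L lo hi) 1 ?C"
    using assms(1,2) single_diagonal_impl[of c "strip L lo hi" L "\<lambda>i. cis (\<alpha> i)"]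
      single_diagonal_impl[of t "strip L lo hi" L "\<lambda>i. cis (if i then \<beta> else 0)"]
      single_diagonal_impl[of t "strip L lo hi" L "\<lambda>i. cis (if i then \<gamma> else 0)"]
    by (auto simp: strip_sites)
  have X: "gates_impl L (strip L lo hi) (4 ^ n) ?X"
    using cnot_op_impl assms by blast
  have "mmult L ?B (mmult L ?A (mmult L ?X (mmult L ?C ?X)))
      = ?D (\<lambda>b. cis (if b t then \<beta> else 0) * (cis (\<alpha> (b c)) * cis (if b t \<noteq> b c then \<gamma> else 0)))"
    using assms(1-3) by (simp add: cnot_op_def mmult_monomial strip_sites cnot_cnot cnot_apply)
  also have "\<dots> = ?D (\<lambda>b. f (b c) (b t))"
    by (rule monomial_cong) (auto simp: F F_eq cis_mult add_ac)
  finally show ?thesis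
    using gates_impl_mmult[OF gates_impl_mmult[OF gates_impl_mmult[OF gates_impl_mmult[OF X C] X] A] B]
      gates_impl_mono by (simp add: mmult_assoc)
qed

text \<open>The diagonal of a product of controlled-Z gates, one for each pair in \<open>I\<close>.
  Every change of mode ordering below is such a sign.\<close>

definition pair_sign :: "(site \<times> site) set \<Rightarrow> cfg \<Rightarrow> complex" where
  "pair_sign I b = (\<Prod>(u, v)\<in>I. if b u \<and> b v then -1 else 1)"

lemma pair_sign_insert:
  "finite I \<Longrightarrow> (u, v) \<notin> I \<Longrightarrow> pair_sign (insert (u, v) I) b = (if b u \<and> b v then -1 else 1) * pair_sign I b"
  by (simp add: pair_sign_def)

lemma pair_sign_square [simp]: "pair_sign I b * pair_sign I b = 1"
  unfolding pair_sign_def prod.distrib[symmetric] by (rule prod.neutral) auto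

lemma cnj_pair_sign [simp]: "cnj (pair_sign I b) = pair_sign I b"
  by (auto simp: pair_sign_def intro!: prod.cong)

lemma pair_sign_impl:
  assumes "finite I" "\<And>u v. (u, v) \<in> I \<Longrightarrow> u \<in> strip L lo hi \<and> v \<in> strip L lo hi \<and> u \<noteq> v \<and> l1_dist u v \<le> n"
  shows "gates_impl L (strip L lo hi) (card I * (3 + 2 * 4 ^ n)) (monomial L (\<lambda>b. b) (pair_sign I))"
  using assms
proof (induction I)
  case empty
  have "pair_sign {} = (\<lambda>_. 1)" by (simp add: pair_sign_def fun_eq_iff)
  then show ?case using gates_impl_ident by (simp add: ident_eq_monomial)
next
  case (insert p I)
  obtain u v where p: "p = (u, v)" by fastforce
  let ?f = "\<lambda>i j. if i \<and> j then -1 else 1 :: complex"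
  have "gates_impl L (strip L lo hi) (card I * (3 + 2 * 4 ^ n) + (3 + 2 * 4 ^ n))
      (mmult L (monomial L (\<lambda>b. b) (\<lambda>b. ?f (b u) (b v))) (monomial L (\<lambda>b. b) (pair_sign I)))"
  proof (intro gates_impl_mmult phase2_impl)
    show "gates_impl L (strip L lo hi) (card I * (3 + 2 * 4 ^ n)) (monomial L (\<lambda>b. b) (pair_sign I))"
      by (rule insert.IH) (rule insert.prems, simp)
    have uv: "u \<in> strip L lo hi \<and> v \<in> strip L lo hi \<and> u \<noteq> v \<and> l1_dist u v \<le> n"
      by (rule insert.prems) (simp add: p)
    then show "u \<in> strip L lo hi" "v \<in> strip L lo hi" "u \<noteq> v" "l1_dist u v \<le> n" by simp_all
  qed simp
  moreover have "mmult L (monomial L (\<lambda>b. b) (\<lambda>b. ?f (b u) (b v))) (monomial L (\<lambda>b. b) (pair_sign I))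
      = monomial L (\<lambda>b. b) (pair_sign (insert p I))"
    using insert.hyps by (subst mmult_monomial) (auto simp: p pair_sign_insert intro: monomial_cong)
  ultimately show ?case using insert.hyps by (simp add: add.commute)
qed

subsection \<open>Multiplexed single-qubit operators\<close>

text \<open>A block-diagonal matrix: the bit at \<open>y\<close> selects the 2x2 matrix
  \<open>u k\<close> that acts on \<open>x\<close>. For \<open>x \<noteq> y\<close> the control may
  be read from either configuration, because they agree off \<open>x\<close>.\<close>

definition mux :: "nat \<Rightarrow> site \<Rightarrow> site \<Rightarrow> (bool \<Rightarrow> bool \<Rightarrow> bool \<Rightarrow> complex) \<Rightarrow> op" where
  "mux L x y u a b = (if a \<in> cfgs L \<and> b \<in> cfgs L \<and> (\<forall>z. z \<noteq> x \<longrightarrow> a z = b z)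
     then u (b y) (a x) (b x) else 0)"

lemma wf_mux [simp]: "wf_op L (mux L x y u)"
  by (auto simp: wf_op_def mux_def)

lemma mmult_mux:
  assumes "x \<in> sites L" "x \<noteq> y"
  shows "mmult L (mux L x y u) (mux L x y v) = mux L x y (\<lambda>k i j. \<Sum>l\<in>UNIV. u k i l * v k l j)"
proof (rule wf_op_eqI)
  fix a b assume ab: "a \<in> cfgs L" "b \<in> cfgs L"
  have "mmult L (mux L x y u) (mux L x y v) a b = (\<Sum>c\<in>cfgs L. mux L x y u a c * mux L x y v c b)"
    using ab by (rule mmult_apply)
  also have "\<dots> = (\<Sum>c\<in>(\<lambda>i. b(x := i)) ` UNIV. mux L x y u a c * mux L x y v c b)"
  proof (rule sum.mono_neutral_right)
    show "\<forall>c\<in>cfgs L - (\<lambda>i. b(x := i)) ` UNIV. mux L x y u a c * mux L x y v c b = 0"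
    proof
      fix c assume c: "c \<in> cfgs L - (\<lambda>i. b(x := i)) ` UNIV"
      then have "c \<noteq> b(x := c x)" by blast
      have "\<not> (\<forall>z. z \<noteq> x \<longrightarrow> c z = b z)"
      proof
        assume "\<forall>z. z \<noteq> x \<longrightarrow> c z = b z"
        then have "c = b(x := c x)" by (intro ext) simp
        then show False using \<open>c \<noteq> b(x := c x)\<close> by blast
      qed
      then show "mux L x y u a c * mux L x y v c b = 0" by (auto simp: mux_def)
    qed
  qed (use ab assms in auto)
  also have "\<dots> = (\<Sum>i\<in>UNIV. mux L x y u a (b(x := i)) * mux L x y v (b(x := i)) b)"
    by (subst sum.reindex) (auto simp: inj_on_def dest: fun_upd_eqD)
  also have "\<dots> = mux L x y (\<lambda>k i j. \<Sum>l\<in>UNIV. u k i l * v k l j) a b"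
    using ab assms by (auto simp: mux_def sum_bool)
  finally show "mmult L (mux L x y u) (mux L x y v) a b
      = mux L x y (\<lambda>k i j. \<Sum>l\<in>UNIV. u k i l * v k l j) a b" .
qed simp_all

lemma mux_single_impl:
  assumes "x \<in> S" "x \<in> sites L" "unitary2 u"
  shows "gates_impl L S 1 (mux L x y (\<lambda>_. u))"
proof -
  have "mux L x y (\<lambda>_. u) = gate_op L (Single x u)"
    by (intro ext) (auto simp: mux_def)
  then show ?thesis using gates_impl_gate[of L "Single x u" S] assms by simp
qed

lemma mux_diagonal:
  "mux L x y (\<lambda>k i j. if i = j then f k i else 0) = monomial L (\<lambda>b. b) (\<lambda>b. f (b y) (b x))"
proof (intro ext)
  fix a b :: cfg
  have "a = b \<longleftrightarrow> (\<forall>z. z \<noteq> x \<longrightarrow> a z = b z) \<and> a x = b x" by auto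
  then show "mux L x y (\<lambda>k i j. if i = j then f k i else 0) a b = monomial L (\<lambda>b. b) (\<lambda>b. f (b y) (b x)) a b"
    by (auto simp: mux_def monomial_def)
qed

text \<open>Here both blocks share the eigenbasis \<open>V\<close>, so conjugating a two-qubit phase
  by a one-qubit gate suffices.\<close>

lemma mux_impl_aux:
  assumes "x \<in> strip L lo hi" "y \<in> strip L lo hi" "x \<noteq> y" "l1_dist y x \<le> n"
    and "unitary2 V" "unitary2 (\<lambda>i j. cnj (V j i))" "\<And>k i. norm (e k i) = 1"
  shows "gates_impl L (strip L lo hi) (5 + 2 * 4 ^ n)
    (mux L x y (\<lambda>k i j. \<Sum>l\<in>UNIV. V i l * e k l * cnj (V j l)))"
proof -
  have D: "gates_impl L (strip L lo hi) (3 + 2 * 4 ^ n) (mux L x y (\<lambda>k i j. if i = j then e k i else 0))"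
    unfolding mux_diagonal using assms by (intro phase2_impl) auto
  have xs: "x \<in> sites L" using assms(1) by (rule strip_sites)
  have "mmult L (mux L x y (\<lambda>_. V)) (mmult L (mux L x y (\<lambda>k i j. if i = j then e k i else 0))
      (mux L x y (\<lambda>_ i j. cnj (V j i)))) = mux L x y (\<lambda>k i j. \<Sum>l\<in>UNIV. V i l * e k l * cnj (V j l))"
    using assms(3) xs by (simp add: mmult_mux sum_bool mult.assoc)
  then show ?thesis
    using gates_impl_mmult[OF gates_impl_mmult[OF mux_single_impl[OF assms(1) xs assms(6), of y] D]
        mux_single_impl[OF assms(1) xs assms(5), of y]]
    by (simp add: mmult_assoc)
qed

text \<open>When the eigenbasis depends on the control, two multiplexed operators are composed. The
  factor for \<open>m\<close> uses the basis \<open>V m\<close> throughout and has eigenvalues 1 for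
  the other control value, where it therefore collapses to the identity.\<close>

lemma mux_impl:
  assumes "x \<in> strip L lo hi" "y \<in> strip L lo hi" "x \<noteq> y" "l1_dist y x \<le> n"
    and "\<And>k. unitary2 (V k)" "\<And>k. unitary2 (\<lambda>i j. cnj (V k j i))" "\<And>k i. norm (e k i) = 1"
  shows "gates_impl L (strip L lo hi) (10 + 4 * 4 ^ n)
    (mux L x y (\<lambda>k i j. \<Sum>l\<in>UNIV. V k i l * e k l * cnj (V k j l)))"
proof -
  define U where "U m k i j = (\<Sum>l\<in>UNIV. V m i l * (if k = m then e k l else 1) * cnj (V m j l))"
    for m k i j
  have "gates_impl L (strip L lo hi) (5 + 2 * 4 ^ n) (mux L x y (U m))" for m
    unfolding U_def using assms by (intro mux_impl_aux) auto
  from gates_impl_mmult[OF this[of True] this[of False]]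
  have "gates_impl L (strip L lo hi) (10 + 4 * 4 ^ n) (mmult L (mux L x y (U False)) (mux L x y (U True)))"
    by simp
  moreover have "(\<Sum>l\<in>UNIV. U False k i l * U True k l j)
      = (\<Sum>l\<in>UNIV. V k i l * e k l * cnj (V k j l))" for k i j
  proof -
    have off: "U m k i j = (if i = j then 1 else 0)" if "k \<noteq> m" for m k i j
      using assms(5)[of m] that by (simp add: U_def unitary2_def)
    have "U True False i j = (if i = j then 1 else 0)" "U False True i j = (if i = j then 1 else 0)" for i j
      using off[of False True] off[of True False] by simp_all
    moreover have "U k k i j = (\<Sum>l\<in>UNIV. V k i l * e k l * cnj (V k j l))" for i j
      by (simp add: U_def)
    ultimately show ?thesis
      by (cases k; cases i; cases j; simp add: sum_bool)
  qed
  ultimately show ?thesis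
    using assms(1,3) by (simp add: mmult_mux strip_sites)
qed

text \<open>For \<open>q \<noteq> 0\<close> the vectors (q, s) and (-s, conjugate of q) are
  orthogonal, of the same norm, and eigenvectors with eigenvalues p + s and r - s as soon as s^2 +
  (p - r) s = |q|^2. The case \<open>q = 0\<close> is split off because the normalisation could
  vanish there.\<close>

lemma hermitian2_diagonalisation:
  assumes "\<And>i j. h i j = cnj (h j i)"
  shows "\<exists>V \<mu>. unitary2 V \<and> unitary2 (\<lambda>i j. cnj (V j i))
    \<and> (\<forall>i j. h i j = (\<Sum>l\<in>UNIV. V i l * complex_of_real (\<mu> l) * cnj (V j l)))"
proof -
  define p r q where "p = Re (h False False)" "r = Re (h True True)" "q = h False True"
  have h: "h False False = of_real p" "h True True = of_real r" "h False True = q" "h True False = cnj q"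
    using assms[of False False] assms[of True True] assms[of True False]
    by (auto simp: p_r_q_def complex_eq_iff)
  show ?thesis
  proof (cases "q = 0")
    case True
    then show ?thesis using h
      by (intro exI[of _ "\<lambda>i j. if i = j then 1 else 0"] exI[of _ "\<lambda>i. if i then r else p"])
        (auto simp: unitary2_def sum_bool all_bool_eq)
  next
    case False
    define \<Delta> where "\<Delta> = sqrt ((p - r)\<^sup>2 + 4 * (cmod q)\<^sup>2)"
    have \<Delta>2: "\<Delta>\<^sup>2 = (p - r)\<^sup>2 + 4 * (cmod q)\<^sup>2" by (simp add: \<Delta>_def)
    define s where "s = (r - p + \<Delta>) / 2"
    have s: "s\<^sup>2 + (p - r) * s = (cmod q)\<^sup>2"
      using \<Delta>2 by (simp add: s_def power2_eq_square field_simps)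
    define n where "n = sqrt ((cmod q)\<^sup>2 + s\<^sup>2)"
    have n2: "n\<^sup>2 = (cmod q)\<^sup>2 + s\<^sup>2" by (simp add: n_def)
    have n0: "n \<noteq> 0" using False by (simp add: n_def add_nonneg_eq_0_iff)
    have qq: "q * cnj q = of_real ((cmod q)\<^sup>2)" by (simp only: complex_norm_square)
    define V where "V i j = (if j then (if i then cnj q else - of_real s) else if i then of_real s else q) / of_real n"
      for i j
    have nn: "(of_real n :: complex) * of_real n = q * cnj q + of_real s * of_real s"
      using n2 qq by (simp add: power2_eq_square flip: of_real_mult of_real_add)
    have ss: "complex_of_real s * of_real s + (of_real p - of_real r) * of_real s = q * cnj q"
      using s qq by (simp add: power2_eq_square flip: of_real_mult of_real_add of_real_diff)
    have nz: "q * cnj q + complex_of_real s * of_real s \<noteq> 0"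
      using n0 by (simp flip: nn)
    have V: "unitary2 V" "unitary2 (\<lambda>i j. cnj (V j i))"
      using nz by (simp_all add: unitary2_def sum_bool all_bool_eq V_def nn mult.commute add.commute
          flip: add_divide_distrib)
    define \<mu> where "\<mu> i = (if i then r - s else p + s)" for i :: bool
    have nn0: "complex_of_real n * of_real n \<noteq> 0" using n0 by simp
    \<comment> \<open>Multiplying by the squared norm removes all denominators; what remains is
      polynomial and follows from the quadratic equation for \<open>s\<close>.\<close>
    have eq: "(\<Sum>l\<in>UNIV. V i l * complex_of_real (\<mu> l) * cnj (V j l)) * (of_real n * of_real n) = h i j * (of_real n * of_real n)"
      for i j
    proof -
      define W where "W i j = (if j then (if i then cnj q else - of_real s) else if i then of_real s else q)"
        for i j
      have VW: "W i j = V i j * of_real n" for i j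
        using n0 by (simp add: V_def W_def)
      have "(\<Sum>l\<in>UNIV. V i l * complex_of_real (\<mu> l) * cnj (V j l)) * (of_real n * of_real n)
          = (\<Sum>l\<in>UNIV. W i l * complex_of_real (\<mu> l) * cnj (W j l))"
        by (simp add: sum_bool VW algebra_simps)
      also have "\<dots> = h i j * (of_real n * of_real n)"
        unfolding nn using ss
        by (cases i; cases j; simp add: sum_bool h \<mu>_def W_def; algebra)
      finally show ?thesis .
    qed
    have "h i j = (\<Sum>l\<in>UNIV. V i l * complex_of_real (\<mu> l) * cnj (V j l))" for i j
      using eq[of i j] nn0 by (metis mult_right_cancel)
    with V show ?thesis by blast
  qed
qed

subsection \<open>Changing between row-major and column-major order in a strip\<close>

text \<open>Pairs on which the row-major and the column-major order disagree. The cutoff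
  \<open>j\<close> is the induction parameter of a sweep from the last column to the left.\<close>

definition inversions :: "nat \<Rightarrow> nat \<Rightarrow> nat \<Rightarrow> nat \<Rightarrow> (site \<times> site) set" where
  "inversions L lo hi j = {(u, v). u \<in> strip L lo hi \<and> v \<in> strip L lo hi \<and>
     fst u < fst v \<and> snd v < snd u \<and> j \<le> snd v}"

text \<open>Once the qubits of column \<open>Suc j\<close> hold suffix parities, controlled-Z gates
  along these pairs account for all inversions with \<open>v\<close> in column
  \<open>j\<close>.\<close>

definition local_pairs :: "nat \<Rightarrow> nat \<Rightarrow> nat \<Rightarrow> nat \<Rightarrow> (site \<times> site) set" where
  "local_pairs L lo hi j = {(u, v). u \<in> strip L lo hi \<and> v \<in> strip L lo hi \<and>
     fst u < fst v \<and> snd u = Suc j \<and> snd v = j}"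

definition suffix_parity :: "nat \<Rightarrow> nat \<Rightarrow> nat \<Rightarrow> nat \<Rightarrow> cfg \<Rightarrow> cfg" where
  "suffix_parity L lo hi j b z =
     (if z \<in> strip L lo hi \<and> j \<le> snd z then odd (card {c \<in> {snd z..<L}. b (fst z, c)}) else b z)"

text \<open>The rows form an arbitrary set so that the CNOTs of one column can be added one at a
  time by induction.\<close>

definition add_column :: "nat set \<Rightarrow> nat \<Rightarrow> cfg \<Rightarrow> cfg" where
  "add_column R j b z = (if fst z \<in> R \<and> snd z = j then b z \<noteq> b (fst z, Suc j) else b z)"

lemma finite_inversions [simp]: "finite (inversions L lo hi j)"
  by (rule finite_subset[of _ "strip L lo hi \<times> strip L lo hi"]) (auto simp: inversions_def)

lemma finite_local_pairs [simp]: "finite (local_pairs L lo hi j)"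
  by (rule finite_subset[of _ "strip L lo hi \<times> strip L lo hi"]) (auto simp: local_pairs_def)

lemma add_column_in_cfgs:
  "b \<in> cfgs L \<Longrightarrow> R \<subseteq> {..<L} \<Longrightarrow> j < L \<Longrightarrow> add_column R j b \<in> cfgs L"
  by (auto simp: cfgs_def add_column_def sites_def)

lemma suffix_parity_in_cfgs: "b \<in> cfgs L \<Longrightarrow> suffix_parity L lo hi j b \<in> cfgs L"
  by (auto simp: cfgs_def suffix_parity_def dest: strip_sites)

lemma add_column_add_column: "add_column R j (add_column R j b) = b"
  by (rule ext) (auto simp: add_column_def)

lemma suffix_parity_last: "suffix_parity L lo hi (L - 1) b = b"
proof
  fix z
  have "odd (card {c \<in> {L - 1..<L}. b (fst z, c)}) = b z" if "z \<in> strip L lo hi" "snd z = L - 1"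
  proof -
    have "{c \<in> {L - 1..<L}. b (fst z, c)} = (if b z then {L - 1} else {})"
    proof -
      have iv: "{L - 1..<L} = {L - 1}" and "b (fst z, L - 1) = b z"
        using that by (cases z, auto simp: strip_def)+
      then show ?thesis unfolding iv by auto
    qed
    then show ?thesis by simp
  qed
  moreover have "snd z = L - 1" if "z \<in> strip L lo hi" "L - 1 \<le> snd z"
    using that by (auto simp: strip_def)
  ultimately show "suffix_parity L lo hi (L - 1) b z = b z"
    by (auto simp: suffix_parity_def)
qed

lemma suffix_parity_step:
  assumes "Suc j < L"
  shows "suffix_parity L lo hi j b = add_column {lo..<min L hi} j (suffix_parity L lo hi (Suc j) b)"
proof
  fix z
  show "suffix_parity L lo hi j b z = add_column {lo..<min L hi} j (suffix_parity L lo hi (Suc j) b) z"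
  proof (cases "z \<in> strip L lo hi \<and> snd z = j")
    case True
    then have z: "z = (fst z, j)" "(fst z, Suc j) \<in> strip L lo hi" "fst z \<in> {lo..<min L hi}"
      using assms by (auto simp: strip_def)
    have "{c \<in> {j..<L}. b (fst z, c)} =
        (if b z then insert j else id) {c \<in> {Suc j..<L}. b (fst z, c)}"
      using assms z(1) by (auto simp: le_eq_less_or_eq)
    then have "odd (card {c \<in> {j..<L}. b (fst z, c)}) \<longleftrightarrow>
        b z \<noteq> odd (card {c \<in> {Suc j..<L}. b (fst z, c)})"
      by simp
    then show ?thesis using True z by (simp add: suffix_parity_def add_column_def)
  next
    case False
    then have "\<not> (fst z \<in> {lo..<min L hi} \<and> snd z = j)"
      using assms by (cases z) (auto simp: strip_def)
    with False show ?thesis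
      by (auto simp: suffix_parity_def add_column_def)
  qed
qed

lemma prod_sign:
  "finite C \<Longrightarrow> (\<Prod>c\<in>C. if p \<and> P c then -1 else 1 :: complex)
     = (if p \<and> odd (card {c \<in> C. P c}) then -1 else 1)"
proof (induction C rule: finite_induct)
  case (insert x C)
  have "{c \<in> insert x C. P c} = (if P x then insert x else id) {c \<in> C. P c}" by auto
  then show ?case using insert by simp
qed simp

text \<open>For fixed \<open>v\<close> in column \<open>j\<close> and a fixed row of
  \<open>u\<close>, the signs of all admissible columns of \<open>u\<close> multiply to one sign
  that depends on \<open>v\<close> and on the parity of the row suffix after
  \<open>j\<close>.\<close>

lemma pair_sign_inversions_step:
  assumes "Suc j < L"
  shows "pair_sign (inversions L lo hi j) b =
    pair_sign (local_pairs L lo hi j) (suffix_parity L lo hi (Suc j) b) *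
    pair_sign (inversions L lo hi (Suc j)) b"
proof -
  let ?s = "\<lambda>(u, v). if b u \<and> b v then -1 else 1 :: complex"
  define K where "K = {(u, v) \<in> inversions L lo hi j. snd v = j}"
  have K: "inversions L lo hi j = K \<union> inversions L lo hi (Suc j)" "K \<inter> inversions L lo hi (Suc j) = {}" "finite K"
    by (auto simp: K_def inversions_def intro: finite_subset[OF _ finite_inversions])
  \<comment> \<open>An inversion with \<open>v\<close> in column \<open>j\<close> is a local pair,
    which remembers \<open>v\<close> and the row of \<open>u\<close>, together with the column
    \<open>c\<close> of \<open>u\<close>.\<close>
  have "prod ?s K = (\<Prod>(p, c)\<in>local_pairs L lo hi j \<times> {Suc j..<L}. ?s ((fst (fst p), c), snd p))"
  proof (rule prod.reindex_bij_witness[where i = "\<lambda>(p, c). ((fst (fst p), c), snd p)"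
        and j = "\<lambda>(u, v). (((fst u, Suc j), v), snd u)"])
  qed (use assms in \<open>auto simp: K_def inversions_def local_pairs_def strip_def\<close>)
  also have "\<dots> = (\<Prod>p\<in>local_pairs L lo hi j. \<Prod>c\<in>{Suc j..<L}. if b (snd p) \<and> b (fst (fst p), c) then -1 else 1)"
    by (subst prod.cartesian_product) (auto intro!: prod.cong)
  \<comment> \<open>Column \<open>j\<close> still holds its original bits at this stage, while
    column \<open>Suc j\<close> holds exactly the parity over \<open>c\<close>.\<close>
  also have "\<dots> = pair_sign (local_pairs L lo hi j) (suffix_parity L lo hi (Suc j) b)"
    unfolding pair_sign_def
    by (intro prod.cong refl) (auto simp: prod_sign local_pairs_def suffix_parity_def)
  finally show ?thesis
    using K by (simp add: pair_sign_def prod.union_disjoint)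
qed

lemma add_column_impl:
  assumes "finite R" "R \<subseteq> {lo..<min L hi}" "Suc j < L"
  shows "gates_impl L (strip L lo hi) (card R * 4) (monomial L (add_column R j) (\<lambda>_. 1))"
  using assms(1,2)
proof (induction R rule: finite_induct)
  case empty
  have "add_column {} j = (\<lambda>b. b)" by (simp add: add_column_def fun_eq_iff)
  then show ?case using gates_impl_ident by (simp add: ident_eq_monomial)
next
  case (insert i R)
  have mem: "(i, Suc j) \<in> strip L lo hi" "(i, j) \<in> strip L lo hi"
    using insert.prems assms(3) by (auto simp: strip_def)
  have cn: "gates_impl L (strip L lo hi) (4 ^ 1) (cnot_op L (i, Suc j) (i, j))"
    by (rule cnot_op_impl) (use mem in \<open>auto simp: l1_dist_def\<close>)
  have "mmult L (cnot_op L (i, Suc j) (i, j)) (monomial L (add_column R j) (\<lambda>_. 1))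
      = monomial L (\<lambda>b. cnot (i, Suc j) (i, j) (add_column R j b)) (\<lambda>_. 1 * 1)"
    unfolding cnot_op_def using insert.prems assms(3) mem
    by (intro mmult_monomial) (auto simp: add_column_in_cfgs strip_sites subset_iff)
  also have "\<dots> = monomial L (add_column (insert i R) j) (\<lambda>_. 1)"
  proof (rule monomial_cong, intro conjI ext)
    fix b z show "cnot (i, Suc j) (i, j) (add_column R j b) z = add_column (insert i R) j b z"
      using insert.hyps by (cases z) (auto simp: cnot_apply add_column_def)
  qed simp
  finally show ?case
    using gates_impl_mmult[OF insert.IH cn] insert.hyps insert.prems by (simp add: add.commute)
qed

text \<open>\<open>r\<close> bounds the height of the strip. One column needs at most
  \<open>r\<close> CNOTs of cost 4 and \<open>r * r\<close> controlled-Z gates between adjacent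
  columns, at distance at most \<open>r + 1\<close>.\<close>

definition column_cost :: "nat \<Rightarrow> nat" where
  "column_cost r = 4 * r + r * r * (3 + 2 * 4 ^ (r + 1))"

lemma local_pairs_impl:
  assumes "min L hi - lo \<le> r"
  shows "gates_impl L (strip L lo hi) (r * r * (3 + 2 * 4 ^ (r + 1)))
    (monomial L (\<lambda>b. b) (pair_sign (local_pairs L lo hi j)))"
proof -
  have "local_pairs L lo hi j \<subseteq>
      (\<lambda>(i, i'). ((i, Suc j), (i', j))) ` ({lo..<min L hi} \<times> {lo..<min L hi})"
    by (auto simp: local_pairs_def strip_def image_iff)
  from surj_card_le[OF _ this]
  have "card (local_pairs L lo hi j) \<le> (min L hi - lo) * (min L hi - lo)" by simp
  also have "\<dots> \<le> r * r" using assms by (intro mult_mono) auto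
  finally have "card (local_pairs L lo hi j) * (3 + 2 * 4 ^ (r + 1)) \<le> r * r * (3 + 2 * 4 ^ (r + 1))"
    by (intro mult_right_mono) auto
  moreover have "gates_impl L (strip L lo hi) (card (local_pairs L lo hi j) * (3 + 2 * 4 ^ (r + 1)))
      (monomial L (\<lambda>b. b) (pair_sign (local_pairs L lo hi j)))"
    by (rule pair_sign_impl[OF finite_local_pairs])
      (use assms in \<open>auto simp: local_pairs_def strip_def l1_dist_def\<close>)
  ultimately show ?thesis by (rule gates_impl_mono[rotated])
qed

lemma add_column_strip_impl:
  assumes "min L hi - lo \<le> r" "Suc j < L"
  shows "gates_impl L (strip L lo hi) (4 * r) (monomial L (add_column {lo..<min L hi} j) (\<lambda>_. 1))"
  using add_column_impl[of "{lo..<min L hi}" lo L hi j] assms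
  by (auto elim!: gates_impl_mono)

text \<open>Invariant of the sweep after \<open>k\<close> steps from the right. The register has
  been changed by the accumulated parities, but the collected phase is expressed in the original
  configuration.\<close>

lemma suffix_parity_impl:
  assumes "min L hi - lo \<le> r" "k \<le> L - 1"
  shows "gates_impl L (strip L lo hi) (k * column_cost r)
    (monomial L (suffix_parity L lo hi (L - 1 - k)) (pair_sign (inversions L lo hi (L - 1 - k))))"
  using assms(2)
proof (induction k)
  case 0
  have "inversions L lo hi (L - 1) = {}" by (auto simp: inversions_def strip_def)
  then have "pair_sign (inversions L lo hi (L - 1)) = (\<lambda>_. 1)"
    by (simp add: pair_sign_def fun_eq_iff)
  moreover have "suffix_parity L lo hi (L - 1) = (\<lambda>b. b)"
    by (rule ext) (rule suffix_parity_last)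
  ultimately show ?case using gates_impl_ident by (simp add: ident_eq_monomial)
next
  case (Suc k)
  define j where "j = L - 1 - Suc k"
  have j: "Suc j = L - 1 - k" "Suc j < L" using Suc.prems by (auto simp: j_def)
  let ?R = "{lo..<min L hi}"
  have "gates_impl L (strip L lo hi) (k * column_cost r)
    (monomial L (suffix_parity L lo hi (Suc j)) (pair_sign (inversions L lo hi (Suc j))))"
    using Suc by (simp add: j)
  from gates_impl_mmult[OF gates_impl_mmult[OF this local_pairs_impl[OF assms(1), of j]]
      add_column_strip_impl[OF assms(1) j(2)]]
  have "gates_impl L (strip L lo hi) (Suc k * column_cost r)
    (mmult L (monomial L (add_column ?R j) (\<lambda>_. 1))
      (mmult L (monomial L (\<lambda>b. b) (pair_sign (local_pairs L lo hi j)))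
        (monomial L (suffix_parity L lo hi (Suc j)) (pair_sign (inversions L lo hi (Suc j))))))"
    by (rule gates_impl_mono) (simp add: column_cost_def)
  moreover have "mmult L (monomial L (add_column ?R j) (\<lambda>_. 1))
      (mmult L (monomial L (\<lambda>b. b) (pair_sign (local_pairs L lo hi j)))
        (monomial L (suffix_parity L lo hi (Suc j)) (pair_sign (inversions L lo hi (Suc j)))))
    = monomial L (\<lambda>b. add_column ?R j (suffix_parity L lo hi (Suc j) b))
       (\<lambda>b. pair_sign (local_pairs L lo hi j) (suffix_parity L lo hi (Suc j) b) *
         pair_sign (inversions L lo hi (Suc j)) b)"
    using j(2) by (simp add: mmult_monomial suffix_parity_in_cfgs add_column_in_cfgs subset_iff)
  moreover have "\<dots> = monomial L (suffix_parity L lo hi j) (pair_sign (inversions L lo hi j))"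
    using suffix_parity_step[OF j(2)] pair_sign_inversions_step[OF j(2)]
    by (intro monomial_cong) auto
  ultimately show ?case by (simp add: j_def)
qed

text \<open>Each column of CNOTs is an involution, so applying them in reverse order clears the
  parities. Quantifying over the phase lets the collected sign pass through unchanged.\<close>

lemma suffix_parity_undo_impl:
  assumes "min L hi - lo \<le> r" "k \<le> L - 1"
  shows "\<exists>U. gates_impl L (strip L lo hi) (k * column_cost r) U \<and>
    (\<forall>\<phi>. mmult L U (monomial L (suffix_parity L lo hi (L - 1 - k)) \<phi>) = monomial L (\<lambda>b. b) \<phi>)"
  using assms(2)
proof (induction k)
  case 0
  have "suffix_parity L lo hi (L - 1) = (\<lambda>b. b)"
    by (rule ext) (rule suffix_parity_last)
  then show ?case
    using gates_impl_ident by (intro exI[of _ "ident L"]) simp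
next
  case (Suc k)
  define j where "j = L - 1 - Suc k"
  have j: "Suc j = L - 1 - k" "Suc j < L" using Suc.prems by (auto simp: j_def)
  let ?X = "monomial L (add_column {lo..<min L hi} j) (\<lambda>_. 1)"
  obtain U where U: "gates_impl L (strip L lo hi) (k * column_cost r) U"
    "\<And>\<phi>. mmult L U (monomial L (suffix_parity L lo hi (Suc j)) \<phi>) = monomial L (\<lambda>b. b) \<phi>"
    using Suc j by auto
  have "gates_impl L (strip L lo hi) (Suc k * column_cost r) (mmult L U ?X)"
    using gates_impl_mmult[OF add_column_strip_impl[OF assms(1) j(2)] U(1)]
    by (rule gates_impl_mono) (simp add: column_cost_def)
  moreover have "mmult L (mmult L U ?X) (monomial L (suffix_parity L lo hi j) \<phi>) = monomial L (\<lambda>b. b) \<phi>" for \<phi>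
  proof -
    have "mmult L ?X (monomial L (suffix_parity L lo hi j) \<phi>)
        = monomial L (\<lambda>b. add_column {lo..<min L hi} j (suffix_parity L lo hi j b)) (\<lambda>b. 1 * \<phi> b)"
      using j(2) by (intro mmult_monomial) (auto simp: suffix_parity_in_cfgs add_column_in_cfgs subset_iff)
    also have "\<dots> = monomial L (suffix_parity L lo hi (Suc j)) \<phi>"
      using suffix_parity_step[OF j(2)] by (intro monomial_cong) (simp add: add_column_add_column)
    finally show ?thesis by (simp add: mmult_assoc U)
  qed
  ultimately show ?case by (auto simp: j_def)
qed

text \<open>Mode \<open>x\<close> stays on qubit \<open>x\<close> in every ordering, so a change of
  ordering moves no qubit and is only this fermionic exchange sign.\<close>

definition reorder_op :: "nat \<Rightarrow> nat \<Rightarrow> nat \<Rightarrow> op" where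
  "reorder_op L lo hi = monomial L (\<lambda>b. b) (pair_sign (inversions L lo hi 0))"

lemma wf_reorder_op [simp]: "wf_op L (reorder_op L lo hi)"
  by (simp add: reorder_op_def)

lemma reorder_op_square: "mmult L (reorder_op L lo hi) (reorder_op L lo hi) = ident L"
  unfolding reorder_op_def ident_eq_monomial
  by (subst mmult_monomial) (auto intro: monomial_cong)

lemma reorder_op_impl:
  assumes "min L hi - lo \<le> r"
  shows "gates_impl L (strip L lo hi) (2 * L * column_cost r) (reorder_op L lo hi)"
proof -
  obtain U where U: "gates_impl L (strip L lo hi) ((L - 1) * column_cost r) U"
    "\<And>\<phi>. mmult L U (monomial L (suffix_parity L lo hi 0) \<phi>) = monomial L (\<lambda>b. b) \<phi>"
    using suffix_parity_undo_impl[OF assms, of "L - 1"] by auto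
  have "gates_impl L (strip L lo hi) ((L - 1) * column_cost r)
    (monomial L (suffix_parity L lo hi 0) (pair_sign (inversions L lo hi 0)))"
    using suffix_parity_impl[OF assms, of "L - 1"] by simp
  from gates_impl_mmult[OF this U(1)]
  have "gates_impl L (strip L lo hi) ((L - 1) * column_cost r + (L - 1) * column_cost r) (reorder_op L lo hi)"
    by (simp add: U reorder_op_def)
  then show ?thesis
    by (rule gates_impl_mono) (auto simp: mult_2 intro!: add_mono simp flip: add_mult_distrib)
qed

subsection \<open>Parity-even operators on two modes\<close>

text \<open>In the application \<open>d\<close> is the sign change to an ordering in which \<open>x\<close> and \<open>y\<close> are
  consecutive, and \<open>\<tau>\<close> is the parity of all modes preceding them.\<close>

locale adjacent_modes =
  fixes L :: nat and x y :: site and d \<tau> :: "cfg \<Rightarrow> complex"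
  assumes x_site: "x \<in> sites L" and y_site: "y \<in> sites L" and x_neq_y: "x \<noteq> y"
    and d_square: "d b * d b = 1" and \<tau>_square: "\<tau> b * \<tau> b = 1"
    and d_real: "cnj (d b) = d b" and \<tau>_real: "cnj (\<tau> b) = \<tau> b"
    and \<tau>_cong: "(\<And>z. z \<noteq> x \<Longrightarrow> z \<noteq> y \<Longrightarrow> a z = b z) \<Longrightarrow> \<tau> a = \<tau> b"
    and ann_x: "a \<in> cfgs L \<Longrightarrow> b \<in> cfgs L \<Longrightarrow>
      ann L x a b = (if b x \<and> a = flip b x then d a * d b * \<tau> b else 0)"
    and ann_y: "a \<in> cfgs L \<Longrightarrow> b \<in> cfgs L \<Longrightarrow>
      ann L y a b = (if b y \<and> a = flip b y then d a * d b * \<tau> b * (if b x then -1 else 1) else 0)"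
begin

definition agree :: "cfg \<Rightarrow> cfg \<Rightarrow> bool" where
  "agree a b \<longleftrightarrow> (\<forall>z. z \<noteq> x \<longrightarrow> z \<noteq> y \<longrightarrow> a z = b z)"

text \<open>Up to conjugation by \<open>d\<close> this is a 4x4 matrix on the two modes, whose
  entries that change their joint parity carry the common string \<tau>. The class contains the four
  ladder operators and is closed under the operations of \<open>gen_alg\<close>, so it contains the
  whole generated algebra.\<close>

definition semilocal :: "(bool \<Rightarrow> bool \<Rightarrow> bool \<Rightarrow> bool \<Rightarrow> complex) \<Rightarrow> op" where
  "semilocal w a b = (if a \<in> cfgs L \<and> b \<in> cfgs L \<and> agree a b
     then d a * d b * (if (a x = a y) = (b x = b y) then 1 else \<tau> b) * w (a x) (a y) (b x) (b y) else 0)"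

lemma wf_semilocal [simp]: "wf_op L (semilocal w)"
  by (auto simp: wf_op_def semilocal_def)

lemma agree_\<tau>: "agree a b \<Longrightarrow> \<tau> a = \<tau> b"
  by (rule \<tau>_cong) (auto simp: agree_def)

lemma eq_iff_agree: "a = b \<longleftrightarrow> agree a b \<and> a x = b x \<and> a y = b y"
proof
  assume *: "agree a b \<and> a x = b x \<and> a y = b y"
  show "a = b"
  proof
    fix z show "a z = b z" using * by (cases "z = x \<or> z = y") (auto simp: agree_def)
  qed
qed (simp add: agree_def)

lemma agree_upd: "agree a b \<Longrightarrow> agree a (b(x := i, y := j))"
  by (auto simp: agree_def)

lemma sum_agree:
  assumes "b \<in> cfgs L" "\<And>c. c \<in> cfgs L \<Longrightarrow> \<not> agree c b \<Longrightarrow> g c = (0 :: complex)"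
  shows "(\<Sum>c\<in>cfgs L. g c) = (\<Sum>i\<in>UNIV. \<Sum>j\<in>UNIV. g (b(x := i, y := j)))"
proof -
  let ?u = "\<lambda>(i, j). b(x := i, y := j)"
  have "(\<Sum>c\<in>cfgs L. g c) = (\<Sum>c\<in>range ?u. g c)"
  proof (rule sum.mono_neutral_right)
    show "range ?u \<subseteq> cfgs L" using assms(1) x_site y_site by auto
    show "\<forall>c\<in>cfgs L - range ?u. g c = 0"
    proof
      fix c assume c: "c \<in> cfgs L - range ?u"
      have "c \<noteq> ?u (c x, c y)"
      proof
        assume "c = ?u (c x, c y)"
        then have "c \<in> range ?u" by (rule range_eqI)
        with c show False by simp
      qed
      moreover have "c = ?u (c x, c y)" if "agree c b"
        using that by (intro ext) (simp add: agree_def)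
      ultimately show "g c = 0" using assms(2) c by blast
    qed
  qed simp
  also have "\<dots> = (\<Sum>p\<in>UNIV. g (?u p))"
  proof (rule sum.reindex[unfolded comp_def])
    show "inj ?u"
    proof (rule injI)
      fix p q assume eq: "?u p = ?u q"
      obtain i j k l where pq: "p = (i, j)" "q = (k, l)" by fastforce
      from eq have "?u p x = ?u q x" "?u p y = ?u q y" by simp_all
      then show "p = q" using x_neq_y by (simp add: pq)
    qed
  qed
  also have "\<dots> = (\<Sum>i\<in>UNIV. \<Sum>j\<in>UNIV. g (b(x := i, y := j)))"
    by (subst UNIV_Times_UNIV[symmetric], subst sum.cartesian_product) (auto intro: sum.cong)
  finally show ?thesis .
qed

lemma mmult_semilocal:
  "mmult L (semilocal v) (semilocal w)
    = semilocal (\<lambda>i j i' j'. \<Sum>k\<in>UNIV. \<Sum>l\<in>UNIV. v i j k l * w k l i' j')"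
proof (rule wf_op_eqI)
  fix a b assume ab: "a \<in> cfgs L" "b \<in> cfgs L"
  have "mmult L (semilocal v) (semilocal w) a b
      = (\<Sum>k\<in>UNIV. \<Sum>l\<in>UNIV. semilocal v a (b(x := k, y := l)) * semilocal w (b(x := k, y := l)) b)"
    unfolding mmult_apply[OF ab] using ab(2) by (rule sum_agree) (simp add: semilocal_def)
  also have "\<dots> = semilocal (\<lambda>i j i' j'. \<Sum>k\<in>UNIV. \<Sum>l\<in>UNIV. v i j k l * w k l i' j') a b"
  proof (cases "agree a b")
    case True
    have "semilocal v a (b(x := k, y := l)) * semilocal w (b(x := k, y := l)) b
       = d a * d b * (if (a x = a y) = (b x = b y) then 1 else \<tau> b) * (v (a x) (a y) k l * w k l (b x) (b y))"
      for k l
    proof -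
      define c where "c = b(x := k, y := l)"
      have c: "c \<in> cfgs L" "agree a c" "agree c b" "c x = k" "c y = l"
        using ab x_site y_site True x_neq_y by (auto simp: c_def agree_upd) (auto simp: agree_def)
      have "semilocal v a c * semilocal w c b
        = d a * d b * (d c * d c) * ((if (a x = a y) = (k = l) then 1 else \<tau> b) * (if (k = l) = (b x = b y) then 1 else \<tau> b))
         * (v (a x) (a y) k l * w k l (b x) (b y))"
        using c ab agree_\<tau>[OF c(3)] by (simp only: semilocal_def simp_thms if_True) (simp only: mult_ac)
      \<comment> \<open>Parity changes add modulo two: two odd factors produce the square of \<tau>,
        which is 1.\<close>
      also have "(if (a x = a y) = (k = l) then 1 else \<tau> b) * (if (k = l) = (b x = b y) then 1 else \<tau> b)
        = (if (a x = a y) = (b x = b y) then 1 else \<tau> b)"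
        using \<tau>_square[of b] by auto
      finally show ?thesis unfolding d_square c_def by (simp only: mult_1_right)
    qed
    then show ?thesis using ab True
      by (simp add: semilocal_def sum_bool distrib_left)
  next
    case False
    then have "\<not> agree a (b(x := k, y := l))" for k l
      by (auto simp: agree_def split: if_splits)
    with False show ?thesis by (simp add: semilocal_def)
  qed
  finally show "mmult L (semilocal v) (semilocal w) a b
    = semilocal (\<lambda>i j i' j'. \<Sum>k\<in>UNIV. \<Sum>l\<in>UNIV. v i j k l * w k l i' j') a b" .
qed simp_all

lemma adj_semilocal: "adj (semilocal w) = semilocal (\<lambda>i j i' j'. cnj (w i' j' i j))"
proof (intro ext)
  fix a b
  have "agree b a = agree a b" by (auto simp: agree_def)
  then show "adj (semilocal w) a b = semilocal (\<lambda>i j i' j'. cnj (w i' j' i j)) a b"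
    using agree_\<tau>[of a b] by (auto simp: adj_def semilocal_def d_real \<tau>_real)
qed

lemma ann_x_semilocal: "ann L x = semilocal (\<lambda>i j i' j'. if \<not> i \<and> i' \<and> j = j' then 1 else 0)"
proof (rule wf_op_eqI)
  fix a b assume ab: "a \<in> cfgs L" "b \<in> cfgs L"
  have "b x \<and> a = flip b x \<longleftrightarrow> agree a b \<and> \<not> a x \<and> b x \<and> a y = b y"
    using x_neq_y by (auto simp: eq_iff_agree[of a "flip b x"] flip_apply agree_def)
  then show "ann L x a b = semilocal (\<lambda>i j i' j'. if \<not> i \<and> i' \<and> j = j' then 1 else 0) a b"
    using ab by (auto simp: ann_x semilocal_def)
qed simp_all

text \<open>The sign attached to an occupied \<open>x\<close> is the part of the string of
  \<open>y\<close> that lies inside the pair, as \<open>x\<close> comes directly before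
  \<open>y\<close>.\<close>

lemma ann_y_semilocal:
  "ann L y = semilocal (\<lambda>i j i' j'. if i = i' \<and> \<not> j \<and> j' then if i' then -1 else 1 else 0)"
proof (rule wf_op_eqI)
  fix a b assume ab: "a \<in> cfgs L" "b \<in> cfgs L"
  have "b y \<and> a = flip b y \<longleftrightarrow> agree a b \<and> a x = b x \<and> \<not> a y \<and> b y"
    using x_neq_y by (auto simp: eq_iff_agree[of a "flip b y"] flip_apply agree_def)
  then show "ann L y a b
      = semilocal (\<lambda>i j i' j'. if i = i' \<and> \<not> j \<and> j' then if i' then -1 else 1 else 0) a b"
    using ab by (auto simp: ann_y semilocal_def)
qed simp_all

lemma ident_semilocal: "ident L = semilocal (\<lambda>i j i' j'. if i = i' \<and> j = j' then 1 else 0)"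
proof (rule wf_op_eqI)
  fix a b assume ab: "a \<in> cfgs L" "b \<in> cfgs L"
  have "a = b \<longleftrightarrow> agree a b \<and> a x = b x \<and> a y = b y"
    by (rule eq_iff_agree)
  then show "ident L a b = semilocal (\<lambda>i j i' j'. if i = i' \<and> j = j' then 1 else 0) a b"
    using ab by (auto simp: ident_def semilocal_def d_square)
qed simp_all

lemma gen_alg_semilocal:
  assumes "A \<in> gen_alg L {ann L x, ann L y, adj (ann L x), adj (ann L y)}"
  shows "A \<in> range semilocal"
  using assms
proof induction
  case (gen g)
  have "ann L x \<in> range semilocal" "ann L y \<in> range semilocal"
    by (rule range_eqI, rule ann_x_semilocal, rule range_eqI, rule ann_y_semilocal)
  moreover have "adj B \<in> range semilocal" if "B \<in> range semilocal" for B
  proof -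
    from that obtain w where "B = semilocal w" by blast
    then show ?thesis by (simp add: adj_semilocal)
  qed
  ultimately show ?case using gen by auto
next
  case one
  show ?case by (rule range_eqI) (rule ident_semilocal)
next
  case (add A B)
  then obtain v w where "A = semilocal v" "B = semilocal w" by blast
  then have "(\<lambda>a b. A a b + B a b) = semilocal (\<lambda>i j i' j'. v i j i' j' + w i j i' j')"
    by (intro ext) (simp add: semilocal_def distrib_left)
  then show ?case by (simp only: rangeI)
next
  case (smult A z)
  then obtain v where "A = semilocal v" by blast
  then have "(\<lambda>a b. z * A a b) = semilocal (\<lambda>i j i' j'. z * v i j i' j')"
    by (intro ext) (simp add: semilocal_def)
  then show ?case by (simp only: rangeI)
next
  case (mult A B)
  then obtain v w where "A = semilocal v" "B = semilocal w" by blast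
  then show ?case by (simp add: mmult_semilocal)
qed

lemma parity2_apply:
  "parity2 L x y = monomial L (\<lambda>b. b) (\<lambda>b. if b x = b y then 1 else -1)"
proof (intro ext)
  fix a b
  have "{z \<in> {x, y}. b z} = (if b x then {x} else {}) \<union> (if b y then {y} else {})" by auto
  then have "(-1) ^ card {z \<in> {x, y}. b z} = (if b x = b y then 1 else -1 :: complex)"
    using x_neq_y by auto
  then show "parity2 L x y a b = monomial L (\<lambda>b. b) (\<lambda>b. if b x = b y then 1 else -1) a b"
    by (auto simp: parity2_def monomial_def)
qed

text \<open>Evenness kills the entries that carry \<tau>. The CNOT from \<open>x\<close> to
  \<open>y\<close> stores the conserved joint parity in \<open>y\<close>, and within a parity sector
  the bit of \<open>x\<close> labels the two basis states; \<open>h k\<close> is the block of sector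
  \<open>k\<close>.\<close>

lemma admissible_term_mux:
  assumes "admissible_term L x y H"
  obtains h where "\<And>k i j. h k i j = cnj (h k j i)"
    and "\<And>a b. a \<in> cfgs L \<Longrightarrow> b \<in> cfgs L \<Longrightarrow> H a b = d a * d b * mux L x y h (cnot x y a) (cnot x y b)"
proof -
  obtain w where w: "H = semilocal w"
    using assms gen_alg_semilocal by (auto simp: admissible_term_def)
  have even: "H a b = 0" if "(a x = a y) \<noteq> (b x = b y)" for a b
  proof (cases "a \<in> cfgs L \<and> b \<in> cfgs L")
    case True
    have "mmult L H (parity2 L x y) a b = mmult L (parity2 L x y) H a b"
      using assms by (simp add: admissible_term_def)
    then have "H a b * (if b x = b y then 1 else -1) = (if a x = a y then 1 else -1) * H a b"
      unfolding parity2_apply using True by (simp add: mmult_monomial_right mmult_diagonal_left)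
    then show ?thesis using that by (cases "a x = a y") auto
  qed (auto simp: w semilocal_def)
  define h where "h k i j = w i (i \<noteq> k) j (j \<noteq> k)" for k i j
  show thesis
  proof
    fix k i j
    \<comment> \<open>Two configurations that realise the entry (i, j) of block \<open>k\<close>, so
      that Hermiticity of \<open>H\<close> can be read off for \<open>h\<close>.\<close>
    define a b where "a = zero_cfg(x := i, y := (i \<noteq> k))" and "b = zero_cfg(x := j, y := (j \<noteq> k))"
    have ab: "a \<in> cfgs L" "b \<in> cfgs L" "agree a b" "agree b a"
      using x_site y_site by (auto simp: a_def b_def agree_def)
    have vals: "a x = i" "a y = (i \<noteq> k)" "b x = j" "b y = (j \<noteq> k)"
      using x_neq_y by (auto simp: a_def b_def)
    have "H a b = d a * d b * h k i j" "H b a = d b * d a * h k j i"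
      using ab vals by (auto simp: w semilocal_def h_def)
    moreover have "H a b = cnj (H b a)"
      using assms by (metis adj_def admissible_term_def)
    moreover have "d a \<noteq> 0" "d b \<noteq> 0" using d_square by (metis mult_zero_left zero_neq_one)+
    ultimately show "h k i j = cnj (h k j i)"
      by (auto simp: d_real)
  next
    fix a b assume ab: "a \<in> cfgs L" "b \<in> cfgs L"
    show "H a b = d a * d b * mux L x y h (cnot x y a) (cnot x y b)"
    proof (cases "(a x = a y) = (b x = b y)")
      case True
      have "(\<forall>z. z \<noteq> x \<longrightarrow> cnot x y a z = cnot x y b z) \<longleftrightarrow> agree a b"
        using True x_neq_y by (auto simp: agree_def cnot_apply)
      moreover have "(a x \<noteq> (b y \<noteq> b x)) = a y" "(b x \<noteq> (b y \<noteq> b x)) = b y"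
        using True by auto
      ultimately show ?thesis
        using True ab x_neq_y y_site
        by (auto simp: w semilocal_def mux_def h_def cnot_apply)
    next
      case False
      then have "mux L x y h (cnot x y a) (cnot x y b) = 0"
        using x_neq_y by (auto simp: mux_def cnot_apply dest: spec[of _ y])
      then show ?thesis using even[OF False] by simp
    qed
  qed
qed

text \<open>Conjugation by the sign \<open>d\<close> and by the CNOT permutation passes through
  powers, so the exponential series is evaluated block by block in the eigenbases. The eigenvalues
  become phases, which makes the compilation exact.\<close>

lemma evo_eq_mux:
  assumes "admissible_term L x y H"
  obtains V e where "\<And>k. unitary2 (V k)" "\<And>k. unitary2 (\<lambda>i j. cnj (V k j i))"
    and "\<And>k l. norm (e k l) = 1"
    and "\<And>a b. a \<in> cfgs L \<Longrightarrow> b \<in> cfgs L \<Longrightarrow> evo L H \<theta> a b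
      = d a * d b * mux L x y (\<lambda>k i j. \<Sum>l\<in>UNIV. V k i l * e k l * cnj (V k j l)) (cnot x y a) (cnot x y b)"
proof -
  obtain h where herm: "\<And>k i j. h k i j = cnj (h k j i)"
    and H: "\<And>a b. a \<in> cfgs L \<Longrightarrow> b \<in> cfgs L \<Longrightarrow> H a b = d a * d b * mux L x y h (cnot x y a) (cnot x y b)"
    using admissible_term_mux[OF assms] by blast
  have "\<forall>k. \<exists>V \<mu>. unitary2 V \<and> unitary2 (\<lambda>i j. cnj (V j i))
    \<and> (\<forall>i j. h k i j = (\<Sum>l\<in>UNIV. V i l * complex_of_real (\<mu> l) * cnj (V j l)))"
    by (intro allI hermitian2_diagonalisation) (rule herm)
  from choice[OF this] obtain V where "\<forall>k. \<exists>\<mu>. unitary2 (V k) \<and> unitary2 (\<lambda>i j. cnj (V k j i))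
    \<and> (\<forall>i j. h k i j = (\<Sum>l\<in>UNIV. V k i l * complex_of_real (\<mu> l) * cnj (V k j l)))" ..
  from choice[OF this] obtain \<mu> where "\<forall>k. unitary2 (V k) \<and> unitary2 (\<lambda>i j. cnj (V k j i))
    \<and> (\<forall>i j. h k i j = (\<Sum>l\<in>UNIV. V k i l * complex_of_real (\<mu> k l) * cnj (V k j l)))" ..
  then have V: "\<And>k. unitary2 (V k)" "\<And>k. unitary2 (\<lambda>i j. cnj (V k j i))"
    and h: "\<And>k i j. h k i j = (\<Sum>l\<in>UNIV. V k i l * complex_of_real (\<mu> k l) * cnj (V k j l))"
    by auto
  let ?f = "cnot x y"
  define c where "c = - (\<i> * complex_of_real \<theta>)"
  \<comment> \<open>The \<open>n\<close>-th power of the block \<open>c * h k\<close>, written in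
    its eigenbasis.\<close>
  define M where "M n = (\<lambda>k i j. \<Sum>l\<in>UNIV. V k i l * (c * of_real (\<mu> k l)) ^ n * cnj (V k j l))" for n
  have f: "bij_betw ?f (cfgs L) (cfgs L)"
    by (rule bij_betw_byWitness[where f' = ?f]) (auto simp: cnot_cnot x_neq_y y_site)
  have orth: "V k False m * cnj (V k False n) + V k True m * cnj (V k True n) = (if m = n then 1 else 0)" for k m n
    using V(2)[of k] by (auto simp: unitary2_def sum_bool mult.commute)
  have M_step: "(\<Sum>l\<in>UNIV. M 1 k i l * M n k l j) = M (Suc n) k i j" for k i j n
  proof -
    define A where "A m = V k i m * (c * of_real (\<mu> k m))" for m
    define C where "C m = (c * of_real (\<mu> k m)) ^ n * cnj (V k j m)" for m
    have "(\<Sum>l\<in>UNIV. M 1 k i l * M n k l j)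
        = (\<Sum>m\<in>UNIV. \<Sum>q\<in>UNIV. A m * C q * (V k False q * cnj (V k False m) + V k True q * cnj (V k True m)))"
      by (simp add: M_def sum_bool A_def C_def algebra_simps)
    also have "\<dots> = (\<Sum>m\<in>UNIV. A m * C m)"
      by (simp only: orth) (simp add: sum_bool)
    finally show ?thesis by (simp add: M_def A_def C_def mult_ac)
  qed
  have pow: "mpow L (\<lambda>a b. c * H a b) n a b = d a * d b * mux L x y (M n) (?f a) (?f b)"
    if "a \<in> cfgs L" "b \<in> cfgs L" for n a b
    using that
  proof (induction n arbitrary: a b)
    case 0
    have "?f a = ?f b \<longleftrightarrow> a = b" using x_neq_y by (metis cnot_cnot)
    moreover have "M 0 = (\<lambda>k i j. if i = j then 1 else 0)"
      using V(1) by (intro ext) (auto simp: M_def unitary2_def)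
    ultimately show ?case
      using 0 mux_diagonal[of L x y "\<lambda>_ _. 1"] y_site
      by (auto simp: monomial_def ident_def d_square)
  next
    case (Suc n)
    have "mpow L (\<lambda>a b. c * H a b) (Suc n) a b
        = (\<Sum>e\<in>cfgs L. d a * d b * (mux L x y (M 1) (?f a) (?f e) * mux L x y (M n) (?f e) (?f b)))"
      unfolding mpow.simps mmult_apply[OF Suc.prems]
    proof (rule sum.cong[OF refl])
      fix e assume e: "e \<in> cfgs L"
      have "mux L x y (M 1) p q = c * mux L x y h p q" for p q
        by (auto simp add: mux_def h M_def sum_bool algebra_simps)
      then have "c * H a e * mpow L (\<lambda>a b. c * H a b) n e b
          = (d a * d e * mux L x y (M 1) (?f a) (?f e)) * (d e * d b * mux L x y (M n) (?f e) (?f b))"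
        unfolding Suc.IH[OF e Suc.prems(2)] H[OF Suc.prems(1) e] by simp
      also have "\<dots> = d a * d b * (d e * d e) * (mux L x y (M 1) (?f a) (?f e) * mux L x y (M n) (?f e) (?f b))"
        by (simp only: mult_ac)
      finally show "c * H a e * mpow L (\<lambda>a b. c * H a b) n e b
          = d a * d b * (mux L x y (M 1) (?f a) (?f e) * mux L x y (M n) (?f e) (?f b))"
        unfolding d_square by (simp only: mult_1_right)
    qed
    \<comment> \<open>The CNOT permutes the configurations, so the intermediate one may be
      renamed.\<close>
    also have "\<dots> = (\<Sum>e\<in>cfgs L. d a * d b * (mux L x y (M 1) (?f a) e * mux L x y (M n) e (?f b)))"
      by (rule sum.reindex_bij_betw[OF f, of
            "\<lambda>e. d a * d b * (mux L x y (M 1) (?f a) e * mux L x y (M n) e (?f b))"])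
    also have "\<dots> = d a * d b * mmult L (mux L x y (M 1)) (mux L x y (M n)) (?f a) (?f b)"
      using Suc.prems y_site by (simp add: mmult_apply sum_distrib_left)
    also have "\<dots> = d a * d b * mux L x y (M (Suc n)) (?f a) (?f b)"
      unfolding mmult_mux[OF x_site x_neq_y] M_step ..
    finally show ?case .
  qed
  define e where "e k l = exp (c * of_real (\<mu> k l))" for k l
  show thesis
  proof (rule that[of V e])
    show "norm (e k l) = 1" for k l
      by (simp add: e_def c_def)
    fix a b assume ab: "a \<in> cfgs L" "b \<in> cfgs L"
    have exp_sums: "(\<lambda>n. z ^ n / of_nat (fact n)) sums exp z" for z :: complex
      using exp_converges[of z] by (simp add: scaleR_conv_of_real divide_inverse mult.commute)
    have M_sums: "(\<lambda>n. M n k i j / of_nat (fact n)) sums (\<Sum>l\<in>UNIV. V k i l * e k l * cnj (V k j l))" for k i j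
    proof -
      have "(\<lambda>n. \<Sum>l\<in>UNIV. V k i l * ((c * of_real (\<mu> k l)) ^ n / of_nat (fact n)) * cnj (V k j l))
        sums (\<Sum>l\<in>UNIV. V k i l * e k l * cnj (V k j l))"
        unfolding e_def by (intro sums_sum sums_mult sums_mult2 exp_sums)
      then show ?thesis by (simp add: M_def sum_bool add_divide_distrib)
    qed
    have "(\<lambda>n. d a * d b * (mux L x y (M n) (?f a) (?f b) / of_nat (fact n))) sums
        (d a * d b * mux L x y (\<lambda>k i j. \<Sum>l\<in>UNIV. V k i l * e k l * cnj (V k j l)) (?f a) (?f b))"
    proof (rule sums_mult)
      show "(\<lambda>n. mux L x y (M n) (?f a) (?f b) / of_nat (fact n)) sums
          mux L x y (\<lambda>k i j. \<Sum>l\<in>UNIV. V k i l * e k l * cnj (V k j l)) (?f a) (?f b)"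
      proof (cases "?f a \<in> cfgs L \<and> ?f b \<in> cfgs L \<and> (\<forall>z. z \<noteq> x \<longrightarrow> ?f a z = ?f b z)")
        case True
        then have "mux L x y u (?f a) (?f b) = u (?f b y) (?f a x) (?f b x)" for u
          by (simp add: mux_def)
        then show ?thesis using M_sums by (simp only:)
      next
        case False
        then have "mux L x y u (?f a) (?f b) = 0" for u
          by (auto simp: mux_def)
        then show ?thesis by simp
      qed
    qed
    then have "(\<lambda>n. mpow L (\<lambda>a b. c * H a b) n a b / of_nat (fact n)) sums
        (d a * d b * mux L x y (\<lambda>k i j. \<Sum>l\<in>UNIV. V k i l * e k l * cnj (V k j l)) (?f a) (?f b))"
      by (simp only: pow[OF ab] times_divide_eq_right)
    then show "evo L H \<theta> a b
        = d a * d b * mux L x y (\<lambda>k i j. \<Sum>l\<in>UNIV. V k i l * e k l * cnj (V k j l)) (?f a) (?f b)"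
      unfolding evo_def mexp_def c_def by (rule sums_unique[symmetric])
  qed (use V in auto)
qed

end

lemma wf_evo: "wf_op L (evo L H \<theta>)"
proof -
  have "wf_op L (mpow L A n)" for A n by (cases n) auto
  then show ?thesis by (auto simp: wf_op_def evo_def mexp_def)
qed

subsection \<open>Jordan-Wigner strings in the strip ordering\<close>

definition string :: "site set \<Rightarrow> cfg \<Rightarrow> complex" where
  "string Z b = (\<Prod>z\<in>Z. if b z then -1 else 1)"

lemma string_square [simp]: "string Z b * string Z b = 1"
  unfolding string_def prod.distrib[symmetric] by (rule prod.neutral) auto

lemma cnj_string [simp]: "cnj (string Z b) = string Z b"
  by (auto simp: string_def intro!: prod.cong)

lemma string_empty [simp]: "string {} b = 1"
  by (simp add: string_def)

lemma string_insert: "finite Z \<Longrightarrow> z \<notin> Z \<Longrightarrow> string (insert z Z) b = (if b z then -1 else 1) * string Z b"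
  by (simp add: string_def)

lemma string_card: "finite Z \<Longrightarrow> string Z b = (-1) ^ card {z \<in> Z. b z}"
  using prod_sign[of Z True b] by (simp add: string_def)

text \<open>Factors from the common sites occur twice and cancel.\<close>

lemma string_symdiff:
  assumes "finite Z" "finite Z'"
  shows "string Z b * string Z' b = string ((Z - Z') \<union> (Z' - Z)) b"
proof -
  have 1: "string Z b = string (Z - Z') b * string (Z \<inter> Z') b"
    unfolding string_def using assms
    by (subst prod.union_disjoint[symmetric]) (auto intro!: prod.cong)
  have 2: "string Z' b = string (Z' - Z) b * string (Z \<inter> Z') b"
    unfolding string_def using assms
    by (subst prod.union_disjoint[symmetric]) (auto intro!: prod.cong)
  have 3: "string ((Z - Z') \<union> (Z' - Z)) b = string (Z - Z') b * string (Z' - Z) b"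
    unfolding string_def using assms by (subst prod.union_disjoint) auto
  have "string Z b * string Z' b
      = string (Z - Z') b * string (Z' - Z) b * (string (Z \<inter> Z') b * string (Z \<inter> Z') b)"
    unfolding 1 2 by (simp only: mult_ac)
  then show ?thesis by (simp add: 3)
qed

definition neighbours :: "(site \<times> site) set \<Rightarrow> site \<Rightarrow> site set" where
  "neighbours I x = {z. (x, z) \<in> I \<or> (z, x) \<in> I}"

lemma finite_neighbours:
  assumes "finite I"
  shows "finite (neighbours I x)"
  by (rule finite_subset[of _ "fst ` I \<union> snd ` I"]) (use assms in \<open>force simp: neighbours_def\<close>)+

text \<open>Conjugating a bit flip at \<open>x\<close> by controlled-Z gates leaves a Z on every
  partner of \<open>x\<close>. The antisymmetry hypothesis rules out loops and pairs listed in both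
  orientations, for which the gates would not give one Z per partner.\<close>

lemma pair_sign_flip:
  assumes "finite I" "\<And>u v. (u, v) \<in> I \<Longrightarrow> (v, u) \<notin> I"
  shows "pair_sign I (flip b x) * pair_sign I b = string (neighbours I x) b"
  using assms
proof (induction I)
  case empty
  then show ?case by (simp add: pair_sign_def neighbours_def)
next
  case (insert p I)
  obtain u v where p: "p = (u, v)" by fastforce
  have uv: "u \<noteq> v" "(v, u) \<notin> I" "(u, v) \<notin> I"
    using insert.prems[of u v] insert.hyps by (auto simp: p)
  have IH: "pair_sign I (flip b x) * pair_sign I b = string (neighbours I x) b"
    by (rule insert.IH) (use insert.prems in blast)
  have "pair_sign (insert p I) (flip b x) * pair_sign (insert p I) b
      = ((if flip b x u \<and> flip b x v then -1 else 1) * (if b u \<and> b v then -1 else 1)) * string (neighbours I x) b"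
    unfolding p pair_sign_insert[OF insert.hyps(1) uv(3)] IH[symmetric] by (simp only: mult_ac)
  also have "\<dots> = string (neighbours (insert p I) x) b"
  proof -
    have fin: "finite (neighbours I x)" using insert.hyps by (simp add: finite_neighbours)
    consider "u = x" | "v = x" | "u \<noteq> x" "v \<noteq> x" by blast
    then show ?thesis
    proof cases
      case 1
      then have "neighbours (insert p I) x = insert v (neighbours I x)" "v \<notin> neighbours I x"
        using uv by (auto simp: neighbours_def p)
      then show ?thesis using 1 uv fin by (simp add: string_insert flip_apply)
    next
      case 2
      then have "neighbours (insert p I) x = insert u (neighbours I x)" "u \<notin> neighbours I x"
        using uv by (auto simp: neighbours_def p)
      then show ?thesis using 2 uv fin by (simp add: string_insert flip_apply)
    next
      case 3
      then have "neighbours (insert p I) x = neighbours I x"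
        by (auto simp: neighbours_def p)
      then show ?thesis using 3 by (simp add: flip_apply)
    qed
  qed
  finally show ?case .
qed

definition col_less :: "site \<Rightarrow> site \<Rightarrow> bool" where
  "col_less u v \<longleftrightarrow> snd u < snd v \<or> (snd u = snd v \<and> fst u < fst v)"

definition between :: "nat \<Rightarrow> nat \<Rightarrow> nat \<Rightarrow> site \<Rightarrow> site \<Rightarrow> site set" where
  "between L lo hi x y = {z \<in> strip L lo hi. col_less x z \<and> col_less z y}"

text \<open>The predecessors of \<open>x\<close> in the mixed ordering: all rows before the strip,
  then the strip column by column, with later rows after it.\<close>

definition preceding :: "nat \<Rightarrow> nat \<Rightarrow> nat \<Rightarrow> site \<Rightarrow> site set" where
  "preceding L lo hi x = {z \<in> sites L. fst z < lo} \<union> {z \<in> strip L lo hi. col_less z x}"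

definition ref_before :: "nat \<Rightarrow> site \<Rightarrow> site set" where
  "ref_before L x = {z \<in> sites L. ref_ord L z < ref_ord L x}"

lemma ref_ord_less_iff:
  assumes "u \<in> sites L" "v \<in> sites L"
  shows "ref_ord L u < ref_ord L v \<longleftrightarrow> fst u < fst v \<or> (fst u = fst v \<and> snd u < snd v)"
proof -
  have less: "ref_ord L u < ref_ord L v" if "fst u < fst v" "u \<in> sites L" for u v
  proof -
    have "snd u < L" using that by (auto simp: sites_def)
    then have "ref_ord L u < (fst u + 1) * L" by (simp add: ref_ord_def)
    also have "\<dots> \<le> fst v * L" using that by (intro mult_right_mono) auto
    finally show ?thesis by (simp add: ref_ord_def)
  qed
  show ?thesis
    using less[of u v] less[of v u] assms
    by (cases "fst u" "fst v" rule: linorder_cases) (auto simp: ref_ord_def)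
qed

lemma finite_between [simp]: "finite (between L lo hi x y)"
  by (simp add: between_def)

lemma finite_preceding [simp]: "finite (preceding L lo hi x)"
  by (simp add: preceding_def)

lemma finite_ref_before [simp]: "finite (ref_before L x)"
  by (simp add: ref_before_def)

text \<open>The partners of \<open>x\<close> under inversion are exactly the modes that change sides
  of \<open>x\<close>, so they convert the row-major string into that of the mixed ordering.\<close>

lemma string_preceding:
  assumes "x \<in> strip L lo hi"
  shows "string (ref_before L x) b * string (neighbours (inversions L lo hi 0) x) b
    = string (preceding L lo hi x) b"
proof -
  let ?J = "ref_before L x" and ?N = "neighbours (inversions L lo hi 0) x"
  have xs: "x \<in> sites L" using assms by (rule strip_sites)
  have "z \<in> (?J - ?N) \<union> (?N - ?J) \<longleftrightarrow> z \<in> preceding L lo hi x" for z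
  proof (cases "z \<in> sites L")
    case True
    have s: "z \<in> strip L lo hi \<longleftrightarrow> lo \<le> fst z \<and> fst z < hi"
      using True by (cases z) (auto simp: strip_def sites_def)
    have sx: "lo \<le> fst x" "fst x < hi" using assms by (auto simp: strip_def)
    show ?thesis
      using True xs assms sx
      by (auto simp: ref_before_def neighbours_def inversions_def preceding_def
          ref_ord_less_iff s col_less_def)
  next
    case False
    then have "z \<notin> strip L lo hi" using strip_sites by blast
    with False show ?thesis
      by (auto simp: ref_before_def neighbours_def inversions_def preceding_def)
  qed
  then have "(?J - ?N) \<union> (?N - ?J) = preceding L lo hi x" by blast
  then show ?thesis by (subst string_symdiff) (simp_all add: finite_neighbours)
qed

lemma string_preceding_between:
  assumes "x \<in> strip L lo hi" "y \<in> strip L lo hi" "col_less x y"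
  shows "string (preceding L lo hi y) b * string (between L lo hi x y) b
    = (if b x then -1 else 1) * string (preceding L lo hi x) b"
proof -
  let ?Z = "preceding L lo hi y" and ?B = "between L lo hi x y"
  have "x \<notin> preceding L lo hi x"
    using assms(1) by (auto simp: preceding_def strip_def col_less_def)
  then have "(if b x then -1 else 1) * string (preceding L lo hi x) b
      = string (insert x (preceding L lo hi x)) b"
    by (simp add: string_insert)
  moreover have "z \<in> (?Z - ?B) \<union> (?B - ?Z) \<longleftrightarrow> z \<in> insert x (preceding L lo hi x)" for z
    using assms
    by (cases z; cases x; cases y) (auto simp: preceding_def between_def col_less_def strip_def)
  then have "(?Z - ?B) \<union> (?B - ?Z) = insert x (preceding L lo hi x)" by blast
  ultimately show ?thesis by (simp add: string_symdiff)
qed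

text \<open>The exchange sign for moving \<open>y\<close> back past the modes between, so that it
  follows \<open>x\<close> directly.\<close>

definition adjoining_sign :: "nat \<Rightarrow> nat \<Rightarrow> nat \<Rightarrow> site \<Rightarrow> site \<Rightarrow> cfg \<Rightarrow> complex" where
  "adjoining_sign L lo hi x y = pair_sign (between L lo hi x y \<times> {y})"

text \<open>By \<open>pair_sign_flip\<close> the reordering sign turns row-major strings into those
  of the mixed ordering, and the adjoining sign deletes the modes between from the string of
  \<open>y\<close>. It does not affect the string of \<open>x\<close>, which has no partner among
  its pairs. The common string contains neither \<open>x\<close> nor \<open>y\<close>, since both
  come later.\<close>

lemma adjacent_modes_strip:
  assumes "x \<in> strip L lo hi" "y \<in> strip L lo hi" "col_less x y"
  shows "adjacent_modes L x y
    (\<lambda>b. pair_sign (inversions L lo hi 0) b * adjoining_sign L lo hi x y b)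
    (string (preceding L lo hi x))"
proof
  let ?I = "inversions L lo hi 0" and ?B = "between L lo hi x y"
  define d where "d b = pair_sign ?I b * adjoining_sign L lo hi x y b" for b
  let ?\<tau> = "string (preceding L lo hi x)"
  show xs: "x \<in> sites L" and ys: "y \<in> sites L" using assms by (auto intro: strip_sites)
  show xy: "x \<noteq> y" using assms(3) by (auto simp: col_less_def)
  show "pair_sign ?I b * adjoining_sign L lo hi x y b * (pair_sign ?I b * adjoining_sign L lo hi x y b) = 1" for b
  proof -
    have "pair_sign ?I b * adjoining_sign L lo hi x y b * (pair_sign ?I b * adjoining_sign L lo hi x y b)
      = (pair_sign ?I b * pair_sign ?I b) * (adjoining_sign L lo hi x y b * adjoining_sign L lo hi x y b)"
      by (simp only: mult_ac)
    then show ?thesis by (simp add: adjoining_sign_def)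
  qed
  show "?\<tau> b * ?\<tau> b = 1" for b by simp
  show "cnj (pair_sign ?I b * adjoining_sign L lo hi x y b) = pair_sign ?I b * adjoining_sign L lo hi x y b" for b
    by (simp add: adjoining_sign_def)
  show "cnj (?\<tau> b) = ?\<tau> b" for b by simp
  show "?\<tau> a = ?\<tau> b" if "\<And>z. z \<noteq> x \<Longrightarrow> z \<noteq> y \<Longrightarrow> a z = b z" for a b
  proof -
    have "a z = b z" if "z \<in> preceding L lo hi x" for z
      by (rule \<open>\<And>z. z \<noteq> x \<Longrightarrow> z \<noteq> y \<Longrightarrow> a z = b z\<close>)
        (use that assms in \<open>auto simp: preceding_def strip_def col_less_def\<close>)
    then show ?thesis by (auto simp: string_def intro!: prod.cong)
  qed
  have ann: "ann L z a b = (if b z \<and> a = flip b z then string (ref_before L z) b else 0)"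
    if "a \<in> cfgs L" "b \<in> cfgs L" for a b z
  proof -
    have "{y \<in> sites L. ref_ord L y < ref_ord L z \<and> b y} = {y \<in> ref_before L z. b y}"
      by (auto simp: ref_before_def)
    then show ?thesis using that by (simp add: ann_def string_card)
  qed
  have flip_I: "pair_sign ?I (flip b z) * pair_sign ?I b = string (neighbours ?I z) b" for b z
    by (rule pair_sign_flip[OF finite_inversions]) (auto simp: inversions_def)
  have B: "y \<notin> ?B" "x \<notin> ?B" by (auto simp: between_def col_less_def)
  have flip_B: "adjoining_sign L lo hi x y (flip b z) * adjoining_sign L lo hi x y b
      = string (neighbours (?B \<times> {y}) z) b" for b z
    unfolding adjoining_sign_def by (rule pair_sign_flip) (use B in auto)
  have nx: "neighbours (?B \<times> {y}) x = {}" and ny: "neighbours (?B \<times> {y}) y = ?B"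
    using B xy by (auto simp: neighbours_def)
  have d_flip: "pair_sign ?I (flip b z) * adjoining_sign L lo hi x y (flip b z)
      * (pair_sign ?I b * adjoining_sign L lo hi x y b)
      = string (neighbours ?I z) b * string (neighbours (?B \<times> {y}) z) b" for b z
    unfolding flip_I[symmetric] flip_B[symmetric] by (simp only: mult_ac)
  have ref: "string (ref_before L z) b = string (neighbours ?I z) b * string (preceding L lo hi z) b"
    if "z \<in> strip L lo hi" for z b
  proof -
    have "string (neighbours ?I z) b * string (preceding L lo hi z) b
        = string (ref_before L z) b * (string (neighbours ?I z) b * string (neighbours ?I z) b)"
      unfolding string_preceding[OF that, symmetric] by (simp only: mult_ac)
    then show ?thesis by simp
  qed
  show "ann L x a b = (if b x \<and> a = flip b x then pair_sign ?I a * adjoining_sign L lo hi x y a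
      * (pair_sign ?I b * adjoining_sign L lo hi x y b) * ?\<tau> b else 0)"
    if "a \<in> cfgs L" "b \<in> cfgs L" for a b
    using ref[OF assms(1)] by (auto simp: ann[OF that] d_flip nx)
  have y_string: "string (preceding L lo hi y) b
      = string ?B b * (?\<tau> b * (if b x then -1 else 1))" for b
  proof -
    have "string ?B b * (?\<tau> b * (if b x then -1 else 1))
        = string ?B b * (string (preceding L lo hi y) b * string ?B b)"
      using string_preceding_between[OF assms] by (simp add: mult.commute)
    also have "\<dots> = string (preceding L lo hi y) b * (string ?B b * string ?B b)"
      by (simp only: mult_ac)
    finally show ?thesis by simp
  qed
  show "ann L y a b = (if b y \<and> a = flip b y then pair_sign ?I a * adjoining_sign L lo hi x y a
      * (pair_sign ?I b * adjoining_sign L lo hi x y b) * ?\<tau> b * (if b x then -1 else 1) else 0)"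
    if "a \<in> cfgs L" "b \<in> cfgs L" for a b
  proof (cases "b y \<and> a = flip b y")
    case True
    then have "ann L y a b = string (neighbours ?I y) b * string (neighbours (?B \<times> {y}) y) b
        * ?\<tau> b * (if b x then -1 else 1)"
      unfolding ann[OF that] ny ref[OF assms(2)] y_string by (simp add: mult.assoc)
    then show ?thesis
      unfolding d_flip[symmetric] using True by simp
  qed (auto simp: ann[OF that])
qed

section \<open>Compiling the evolutions inside one strip\<close>

definition pair_cost :: "nat \<Rightarrow> nat \<Rightarrow> nat" where
  "pair_cost r \<delta> = 2 * (r * (\<delta> + 1) * (3 + 2 * 4 ^ (r + \<delta>))) + 2 * 4 ^ (r + \<delta>) + (10 + 4 * 4 ^ (r + \<delta>))"

text \<open>The reordering on both sides cancels that part of the sign \<open>d\<close>, leaving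
  only the adjoining sign. What is compiled is therefore this sign twice, two CNOTs and one
  multiplexed operator, at a cost independent of \<open>L\<close>.\<close>

lemma evo_pair_impl:
  assumes xy: "x \<in> strip L lo hi" "y \<in> strip L lo hi" "col_less x y" "linf_dist x y \<le> \<delta>"
    and r: "min L hi - lo \<le> r"
    and adm: "admissible_term L x y H"
  shows "gates_impl L (strip L lo hi) (pair_cost r \<delta>)
    (mmult L (reorder_op L lo hi) (mmult L (evo L H \<theta>) (reorder_op L lo hi)))"
proof -
  let ?S = "strip L lo hi" and ?I = "inversions L lo hi 0" and ?B = "between L lo hi x y"
  let ?s = "adjoining_sign L lo hi x y" and ?f = "cnot x y"
  interpret adjacent_modes L x y "\<lambda>b. pair_sign ?I b * ?s b" "string (preceding L lo hi x)"
    using xy(1-3) by (rule adjacent_modes_strip)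
  obtain V e where V: "\<And>k. unitary2 (V k)" "\<And>k. unitary2 (\<lambda>i j. cnj (V k j i))"
    and e: "\<And>k l. norm (e k l) = 1"
    and evo: "\<And>a b. a \<in> cfgs L \<Longrightarrow> b \<in> cfgs L \<Longrightarrow> evo L H \<theta> a b
      = pair_sign ?I a * ?s a * (pair_sign ?I b * ?s b)
        * mux L x y (\<lambda>k i j. \<Sum>l\<in>UNIV. V k i l * e k l * cnj (V k j l)) (?f a) (?f b)"
    using evo_eq_mux[OF adm] by blast
  let ?M = "mux L x y (\<lambda>k i j. \<Sum>l\<in>UNIV. V k i l * e k l * cnj (V k j l))"
  let ?D = "monomial L (\<lambda>b. b) ?s" and ?C = "cnot_op L x y"
  let ?n = "r + \<delta>"
  have rows: "\<bar>int (fst u) - int (fst v)\<bar> \<le> int r" if "u \<in> ?S" "v \<in> ?S" for u v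
    using that r by (auto simp: strip_def)
  have cols: "snd x \<le> snd y" "snd y \<le> snd x + \<delta>"
    using xy(3,4) by (auto simp: col_less_def linf_dist_def)
  have dist: "l1_dist u v \<le> ?n" if "u \<in> ?S" "v \<in> ?S" "\<bar>int (snd u) - int (snd v)\<bar> \<le> int \<delta>" for u v
    using rows[OF that(1,2)] that(3) unfolding l1_dist_def by linarith
  \<comment> \<open>In column-major order the modes between lie in the \<open>\<delta> + 1\<close>
    columns from that of \<open>x\<close> on; this is where the short range of the pair
    enters.\<close>
  have "?B \<subseteq> {lo..<min L hi} \<times> {snd x..snd x + \<delta>}"
    using cols by (auto simp: between_def strip_def col_less_def)
  from card_mono[OF _ this] have "card ?B \<le> (min L hi - lo) * (\<delta> + 1)" by simp
  also have "\<dots> \<le> r * (\<delta> + 1)" using r by (rule mult_right_mono) simp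
  finally have card: "card ?B \<le> r * (\<delta> + 1)" .
  have D: "gates_impl L ?S (r * (\<delta> + 1) * (3 + 2 * 4 ^ ?n)) ?D"
  proof (rule gates_impl_mono)
    show "gates_impl L ?S (card (?B \<times> {y}) * (3 + 2 * 4 ^ ?n)) ?D"
      unfolding adjoining_sign_def
    proof (rule pair_sign_impl)
      fix u v assume "(u, v) \<in> ?B \<times> {y}"
      then have u: "u \<in> ?S" "v = y" "col_less x u" "col_less u y" by (auto simp: between_def)
      then have "l1_dist u y \<le> ?n"
        using cols by (intro dist xy) (auto simp: col_less_def)
      with u xy(2) show "u \<in> ?S \<and> v \<in> ?S \<and> u \<noteq> v \<and> l1_dist u v \<le> ?n"
        by (auto simp: col_less_def)
    qed simp
    show "card (?B \<times> {y}) * (3 + 2 * 4 ^ ?n) \<le> r * (\<delta> + 1) * (3 + 2 * 4 ^ ?n)"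
      using card by (intro mult_right_mono) (auto simp: card_cartesian_product)
  qed
  have C: "gates_impl L ?S (4 ^ ?n) ?C"
    using xy x_neq_y cols by (intro cnot_op_impl dist) auto
  have M: "gates_impl L ?S (10 + 4 * 4 ^ ?n) ?M"
    using xy x_neq_y cols V e by (intro mux_impl dist) auto
  have "mmult L (reorder_op L lo hi) (mmult L (evo L H \<theta>) (reorder_op L lo hi))
      = mmult L ?D (mmult L ?C (mmult L ?M (mmult L ?C ?D)))"
  proof (rule wf_op_eqI)
    fix a b assume ab: "a \<in> cfgs L" "b \<in> cfgs L"
    have f: "?f a \<in> cfgs L" "?f b \<in> cfgs L" using ab y_site by auto
    have "mmult L (reorder_op L lo hi) (mmult L (evo L H \<theta>) (reorder_op L lo hi)) a b
        = pair_sign ?I a * (evo L H \<theta> a b * pair_sign ?I b)"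
      using ab by (simp add: reorder_op_def mmult_diagonal_left mmult_monomial_right)
    also have "\<dots> = (pair_sign ?I a * pair_sign ?I a) * (pair_sign ?I b * pair_sign ?I b)
        * (?s a * (?M (?f a) (?f b) * ?s b))"
      unfolding evo[OF ab] by (simp only: mult_ac)
    also have "\<dots> = ?s a * (?M (?f a) (?f b) * ?s b)"
      by simp
    also have "\<dots> = mmult L ?D (mmult L ?C (mmult L ?M (mmult L ?C ?D))) a b"
      using ab f y_site x_neq_y
      by (simp add: mmult_diagonal_left cnot_op_def mmult_involution_left cnot_cnot
          mmult_monomial mmult_monomial_right)
    finally show "mmult L (reorder_op L lo hi) (mmult L (evo L H \<theta>) (reorder_op L lo hi)) a b
      = mmult L ?D (mmult L ?C (mmult L ?M (mmult L ?C ?D))) a b" .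
  qed simp_all
  moreover have "gates_impl L ?S (pair_cost r \<delta>) (mmult L ?D (mmult L ?C (mmult L ?M (mmult L ?C ?D))))"
    by (rule gates_impl_mono[OF gates_impl_mmult[OF gates_impl_mmult[OF gates_impl_mmult[OF
        gates_impl_mmult[OF D C] M] C] D]]) (simp add: pair_cost_def)
  ultimately show ?thesis by simp
qed

text \<open>Adjacent reorderings of consecutive evolutions cancel, so the part proportional to
  \<open>L\<close> is paid only twice, at \<open>2 * L * column_cost r\<close> each.\<close>

lemma evo_product_strip_impl:
  assumes r: "min L hi - lo \<le> r"
    and adm: "\<And>x y. {x, y} \<in> pairs L \<delta> \<Longrightarrow> admissible_term L x y (H {x, y})"
    and ps: "\<And>p. p \<in> set ps \<Longrightarrow> p \<in> pairs L \<delta> \<and> p \<subseteq> strip L lo hi"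
  shows "gates_impl L (strip L lo hi) (4 * L * column_cost r + length ps * pair_cost r \<delta>)
    (evo_product L H \<theta> ps)"
proof -
  let ?R = "reorder_op L lo hi"
  have RR: "mmult L ?R (mmult L ?R A) = A" if "wf_op L A" for A
    using that by (simp flip: mmult_assoc add: reorder_op_square)
  have conj: "gates_impl L (strip L lo hi) (length ps * pair_cost r \<delta>)
      (mmult L ?R (mmult L (evo_product L H \<theta> ps) ?R))"
    using ps
  proof (induction ps rule: rev_induct)
    case Nil
    then show ?case using gates_impl_ident by (simp add: evo_product_def reorder_op_square)
  next
    case (snoc p ps)
    have p: "p \<in> pairs L \<delta>" "p \<subseteq> strip L lo hi" using snoc.prems by auto
    obtain x y where xy: "p = {x, y}" "x \<noteq> y" "linf_dist x y \<le> \<delta>"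
      using p(1) by (auto simp: pairs_def)
    have sym: "linf_dist y x = linf_dist x y" by (simp add: linf_dist_def abs_minus_commute)
    \<comment> \<open>A pair is unordered and is oriented here by the column-major order.\<close>
    obtain u v where uv: "p = {u, v}" "col_less u v" "linf_dist u v \<le> \<delta>"
    proof (cases "col_less x y")
      case False
      then have "col_less y x"
        using xy(2) by (cases x; cases y) (auto simp: col_less_def)
      then show ?thesis using xy sym by (intro that[of y x]) auto
    qed (use xy in \<open>auto intro: that\<close>)
    have P: "gates_impl L (strip L lo hi) (pair_cost r \<delta>)
        (mmult L ?R (mmult L (evo L (H p) (\<theta> p)) ?R))"
      using uv p r adm[of u v] by (intro evo_pair_impl[of u L lo hi v]) auto
    have IH: "gates_impl L (strip L lo hi) (length ps * pair_cost r \<delta>)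
      (mmult L ?R (mmult L (evo_product L H \<theta> ps) ?R))"
      using snoc by auto
    have "mmult L (mmult L ?R (mmult L (evo L (H p) (\<theta> p)) ?R))
        (mmult L ?R (mmult L (evo_product L H \<theta> ps) ?R))
      = mmult L ?R (mmult L (evo_product L H \<theta> (ps @ [p])) ?R)"
      by (simp add: mmult_assoc RR evo_product_append evo_product_def[of _ _ _ "[p]"] wf_evo)
    then show ?case
      using gates_impl_mmult[OF IH P] by (simp add: add.commute)
  qed
  note R = reorder_op_impl[OF r]
  from gates_impl_mmult[OF gates_impl_mmult[OF R conj] R]
  have "gates_impl L (strip L lo hi)
      (2 * L * column_cost r + length ps * pair_cost r \<delta> + 2 * L * column_cost r)
      (mmult L ?R (mmult L (mmult L ?R (mmult L (evo_product L H \<theta> ps) ?R)) ?R))" .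
  also have "mmult L ?R (mmult L (mmult L ?R (mmult L (evo_product L H \<theta> ps) ?R)) ?R) = evo_product L H \<theta> ps"
    by (simp add: mmult_assoc RR reorder_op_square)
  finally show ?thesis by (rule gates_impl_mono) simp
qed

subsection \<open>Parallel composition of circuits\<close>

text \<open>The entrywise form of an operator on \<open>Q\<close> tensored with the identity on the
  other sites.\<close>

definition acts_on :: "nat \<Rightarrow> site set \<Rightarrow> op \<Rightarrow> bool" where
  "acts_on L Q A \<longleftrightarrow> wf_op L A
     \<and> (\<forall>a b. A a b \<noteq> 0 \<longrightarrow> (\<forall>z. z \<notin> Q \<longrightarrow> a z = b z))
     \<and> (\<forall>a\<in>cfgs L. \<forall>b\<in>cfgs L. \<forall>a'\<in>cfgs L. \<forall>b'\<in>cfgs L.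
          (\<forall>z. z \<notin> Q \<longrightarrow> a z = b z) \<longrightarrow> (\<forall>z. z \<notin> Q \<longrightarrow> a' z = b' z) \<longrightarrow>
          (\<forall>z\<in>Q. a z = a' z \<and> b z = b' z) \<longrightarrow> A a b = A a' b')"

lemma acts_on_outside: "acts_on L Q A \<Longrightarrow> A a b \<noteq> 0 \<Longrightarrow> z \<notin> Q \<Longrightarrow> a z = b z"
  by (simp add: acts_on_def)

lemma acts_on_inside:
  assumes "acts_on L Q A" "a \<in> cfgs L" "b \<in> cfgs L" "a' \<in> cfgs L" "b' \<in> cfgs L"
    and "\<And>z. z \<notin> Q \<Longrightarrow> a z = b z" "\<And>z. z \<notin> Q \<Longrightarrow> a' z = b' z"
    and "\<And>z. z \<in> Q \<Longrightarrow> a z = a' z" "\<And>z. z \<in> Q \<Longrightarrow> b z = b' z"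
  shows "A a b = A a' b'"
  by (rule assms(1)[unfolded acts_on_def, THEN conjunct2, THEN conjunct2, rule_format, OF assms(2-5)])
    (simp_all add: assms(6-9))

text \<open>\<open>B\<close> leaves the sites outside \<open>Q'\<close> as in \<open>b\<close>, and
  \<open>A\<close> then leaves those of \<open>Q'\<close> alone, where the final values of
  \<open>a\<close> must already stand. Only one intermediate configuration survives.\<close>

lemma mmult_disjoint_apply:
  assumes A: "acts_on L Q A" and B: "acts_on L Q' B" and disj: "Q \<inter> Q' = {}"
    and ab: "a \<in> cfgs L" "b \<in> cfgs L"
  defines "c \<equiv> \<lambda>z. if z \<in> Q' then a z else b z"
  shows "mmult L A B a b = A a c * B c b"
proof -
  have c: "c \<in> cfgs L" using ab by (auto simp: c_def cfgs_def)
  have eq: "A a e * B e b = (if e = c then A a c * B c b else 0)" for e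
  proof (cases "A a e * B e b = 0")
    case False
    then have "e z = c z" for z
      using acts_on_outside[OF A, of a e z] acts_on_outside[OF B, of e b z] disj
      by (cases "z \<in> Q'") (auto simp: c_def)
    then show ?thesis by auto
  qed auto
  have "mmult L A B a b = (\<Sum>e\<in>cfgs L. if e = c then A a c * B c b else 0)"
    unfolding mmult_apply[OF ab] by (rule sum.cong[OF refl]) (rule eq)
  then show ?thesis using c by simp
qed

lemma acts_on_commute:
  assumes A: "acts_on L Q A" and B: "acts_on L Q' B" and disj: "Q \<inter> Q' = {}"
  shows "mmult L A B = mmult L B A"
proof (rule wf_op_eqI)
  fix a b assume ab: "a \<in> cfgs L" "b \<in> cfgs L"
  define c where "c z = (if z \<in> Q' then a z else b z)" for z
  define e where "e z = (if z \<in> Q then a z else b z)" for z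
  have ce: "c \<in> cfgs L" "e \<in> cfgs L" using ab by (auto simp: c_def e_def cfgs_def)
  have AB: "mmult L A B a b = A a c * B c b" "mmult L B A a b = B a e * A e b"
    using mmult_disjoint_apply[OF A B disj ab] mmult_disjoint_apply[OF B A _ ab] disj
    by (auto simp: c_def[abs_def] e_def[abs_def] Int_commute)
  show "mmult L A B a b = mmult L B A a b"
  proof (cases "\<forall>z. z \<notin> Q \<longrightarrow> z \<notin> Q' \<longrightarrow> a z = b z")
    case True
    have "A a c = A e b"
      by (rule acts_on_inside[OF A ab(1) ce(1) ce(2) ab(2)])
        (use True disj in \<open>auto simp: c_def e_def\<close>)
    moreover have "B c b = B a e"
      by (rule acts_on_inside[OF B ce(1) ab(2) ab(1) ce(2)])
        (use True disj in \<open>auto simp: c_def e_def\<close>)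
    ultimately show ?thesis unfolding AB by (simp only: mult.commute)
  next
    case False
    then obtain z where z: "z \<notin> Q" "z \<notin> Q'" "a z \<noteq> b z" by blast
    have "A a c = 0" using acts_on_outside[OF A, of a c z] z by (auto simp: c_def)
    moreover have "B a e = 0" using acts_on_outside[OF B, of a e z] z by (auto simp: e_def)
    ultimately show ?thesis by (simp add: AB)
  qed
qed simp_all

lemma gate_op_acts_on:
  assumes "gate_ok L g"
  shows "acts_on L (set (gate_qubits g)) (gate_op L g)"
proof (cases g)
  case (Single q u)
  then show ?thesis using assms by (simp add: acts_on_def wf_op_def)
next
  case (CNOT c t)
  have ct: "c \<noteq> t" using assms CNOT by (auto simp: l1_adjacent_def)
  have eq: "a = (if b c then flip b t else b)
      \<longleftrightarrow> (\<forall>z. z \<notin> {c, t} \<longrightarrow> a z = b z) \<and> a c = b c \<and> a t = (b t \<noteq> b c)" for a b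
  proof
    assume *: "(\<forall>z. z \<notin> {c, t} \<longrightarrow> a z = b z) \<and> a c = b c \<and> a t = (b t \<noteq> b c)"
    have "a z = (if b c then flip b t else b) z" for z
      using * by (cases "z = c \<or> z = t") (auto simp: flip_apply)
    then show "a = (if b c then flip b t else b)" by blast
  qed (use ct in \<open>auto simp: flip_apply\<close>)
  define G where "G = gate_op L g"
  have G: "G a b = (if a \<in> cfgs L \<and> b \<in> cfgs L \<and> (\<forall>z. z \<notin> {c, t} \<longrightarrow> a z = b z)
      \<and> a c = b c \<and> a t = (b t \<noteq> b c) then 1 else 0)" for a b
    by (simp only: G_def CNOT gate_op.simps eq)
  have "acts_on L {c, t} G"
    by (auto simp: acts_on_def wf_op_def G)
  then show ?thesis using CNOT by (simp add: G_def)
qed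

lemma gates_op_Cons: "gate_ok L g \<Longrightarrow> gates_op L (g # gs) = mmult L (gates_op L gs) (gate_op L g)"
  using gates_op_append[of L "[g]" gs] by (simp add: gates_op_single)

lemma gates_op_commute_right:
  assumes "wf_op L A" "\<And>h. h \<in> set hs \<Longrightarrow> gate_ok L h \<and> mmult L A (gate_op L h) = mmult L (gate_op L h) A"
  shows "mmult L A (gates_op L hs) = mmult L (gates_op L hs) A"
  using assms(2)
proof (induction hs)
  case Nil
  then show ?case using assms(1) by simp
next
  case (Cons h hs)
  have "mmult L A (gates_op L (h # hs)) = mmult L (mmult L A (gates_op L hs)) (gate_op L h)"
    using Cons.prems by (simp add: gates_op_Cons mmult_assoc)
  also have "\<dots> = mmult L (gates_op L hs) (mmult L A (gate_op L h))"
    using Cons by (simp add: mmult_assoc)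
  also have "\<dots> = mmult L (gates_op L (h # hs)) A"
    using Cons.prems by (simp add: gates_op_Cons mmult_assoc)
  finally show ?case .
qed

definition gates_on :: "nat \<Rightarrow> site set \<Rightarrow> gate set \<Rightarrow> bool" where
  "gates_on L S G \<longleftrightarrow> (\<forall>g\<in>G. gate_ok L g \<and> set (gate_qubits g) \<subseteq> S)"

lemma gates_op_commute:
  assumes "gates_on L S (set gs)" "gates_on L T (set hs)" "S \<inter> T = {}"
  shows "mmult L (gates_op L gs) (gates_op L hs) = mmult L (gates_op L hs) (gates_op L gs)"
proof (rule gates_op_commute_right)
  fix h assume h: "h \<in> set hs"
  then have h_ok: "gate_ok L h" "set (gate_qubits h) \<subseteq> T" using assms(2) by (auto simp: gates_on_def)
  have "mmult L (gate_op L h) (gates_op L gs) = mmult L (gates_op L gs) (gate_op L h)"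
  proof (rule gates_op_commute_right)
    fix g assume "g \<in> set gs"
    then have g: "gate_ok L g" "set (gate_qubits g) \<subseteq> S" using assms(1) by (auto simp: gates_on_def)
    then show "gate_ok L g \<and> mmult L (gate_op L h) (gate_op L g) = mmult L (gate_op L g) (gate_op L h)"
      using h_ok assms(3) by (intro conjI acts_on_commute[OF gate_op_acts_on gate_op_acts_on]) auto
  qed (use h_ok in simp)
  with h_ok show "gate_ok L h \<and> mmult L (gates_op L gs) (gate_op L h) = mmult L (gate_op L h) (gates_op L gs)"
    by simp
qed simp

fun parallel :: "circuit \<Rightarrow> circuit \<Rightarrow> circuit" where
  "parallel [] D = D"
| "parallel C [] = C"
| "parallel (l # C) (k # D) = (l @ k) # parallel C D"

lemma circuit_op_eq: "circuit_op L C = gates_op L (concat C)"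
  by (simp add: circuit_op_def gates_op_def)

lemma depth_parallel: "depth (parallel C D) = max (depth C) (depth D)"
  by (induction C D rule: parallel.induct) (auto simp: depth_def)

lemma gate_count_parallel: "gate_count (parallel C D) = gate_count C + gate_count D"
  by (induction C D rule: parallel.induct) (auto simp: gate_count_def)

lemma set_concat_parallel: "set (concat (parallel C D)) = set (concat C) \<union> set (concat D)"
  by (induction C D rule: parallel.induct) auto

lemma circuit_ok_parallel:
  assumes "circuit_ok L C" "circuit_ok L D"
    and "gates_on L S (set (concat C))" "gates_on L T (set (concat D))" "S \<inter> T = {}"
  shows "circuit_ok L (parallel C D)"
  using assms
proof (induction C D rule: parallel.induct)
  case (3 l C k D)
  have "circuit_ok L (parallel C D)"
    using "3.prems" by (intro "3.IH") (auto simp: circuit_ok_def gates_on_def)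
  moreover have "set (concat (map gate_qubits l)) \<subseteq> S" "set (concat (map gate_qubits k)) \<subseteq> T"
    using "3.prems" by (auto simp: gates_on_def)
  then have "set (concat (map gate_qubits l)) \<inter> set (concat (map gate_qubits k)) = {}"
    using "3.prems"(5) by blast
  ultimately show ?case
    using "3.prems"(1,2) unfolding circuit_ok_def parallel.simps map_append concat_append distinct_append by auto
qed auto

lemma circuit_op_parallel:
  assumes "gates_on L S (set (concat C))" "gates_on L T (set (concat D))" "S \<inter> T = {}"
  shows "circuit_op L (parallel C D) = mmult L (circuit_op L D) (circuit_op L C)"
  using assms
proof (induction C D rule: parallel.induct)
  case (3 l C k D)
  have IH: "circuit_op L (parallel C D) = mmult L (circuit_op L D) (circuit_op L C)"
    using "3.prems" by (intro "3.IH") (auto simp: gates_on_def)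
  \<comment> \<open>The merged circuit runs the first layer \<open>k\<close> of one circuit before
    the rest \<open>C\<close> of the other; disjoint supports allow it to be moved behind.\<close>
  have "mmult L (gates_op L (concat C)) (gates_op L k) = mmult L (gates_op L k) (gates_op L (concat C))"
    using "3.prems" by (intro gates_op_commute[of L S _ T]) (auto simp: gates_on_def)
  then have "mmult L (gates_op L (concat C)) (mmult L (gates_op L k) A)
      = mmult L (gates_op L k) (mmult L (gates_op L (concat C)) A)" for A
    by (simp flip: mmult_assoc)
  with IH show ?case
    by (simp add: circuit_op_eq gates_op_append mmult_assoc)
qed (auto simp: circuit_op_eq)

definition circuit_impl :: "nat \<Rightarrow> site set \<Rightarrow> nat \<Rightarrow> nat \<Rightarrow> op \<Rightarrow> bool" where
  "circuit_impl L S n d U \<longleftrightarrow> (\<exists>C. circuit_ok L C \<and> gates_on L S (set (concat C))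
     \<and> gate_count C \<le> n \<and> depth C \<le> d \<and> circuit_op L C = U)"

text \<open>With one gate per layer the depth equals the gate count, which is within the depth bound
  because a strip needs only O(L) gates.\<close>

lemma gates_impl_circuit_impl:
  assumes "gates_impl L S n U"
  shows "circuit_impl L S n n U"
proof -
  obtain gs where gs: "gates_on L S (set gs)" "length gs \<le> n" "gates_op L gs = U"
    using assms by (auto simp: gates_impl_def gates_on_def)
  have "distinct (gate_qubits g)" if "gate_ok L g" for g
    using that by (cases g) (auto simp: l1_adjacent_def)
  with gs show ?thesis
    unfolding circuit_impl_def
    by (intro exI[of _ "map (\<lambda>g. [g]) gs"])
      (auto simp: circuit_ok_def gates_on_def gate_count_def depth_def circuit_op_eq)
qed

lemma circuit_impl_parallel:
  assumes "circuit_impl L S n d U" "circuit_impl L T m d V" "S \<inter> T = {}"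
  shows "circuit_impl L (S \<union> T) (n + m) d (mmult L V U)"
proof -
  obtain C D where CD: "circuit_ok L C" "gates_on L S (set (concat C))" "gate_count C \<le> n" "depth C \<le> d"
    "circuit_op L C = U" "circuit_ok L D" "gates_on L T (set (concat D))" "gate_count D \<le> m" "depth D \<le> d"
    "circuit_op L D = V"
    using assms by (auto simp: circuit_impl_def)
  have "gates_on L (S \<union> T) (set (concat (parallel C D)))"
    using CD unfolding set_concat_parallel gates_on_def by blast
  then show ?thesis
    unfolding circuit_impl_def using CD assms(3)
    by (intro exI[of _ "parallel C D"])
      (auto simp: circuit_ok_parallel circuit_op_parallel gate_count_parallel depth_parallel)
qed

lemma circuit_impl_sequential:
  assumes "circuit_impl L S n d U" "circuit_impl L T m e V"
  shows "circuit_impl L (S \<union> T) (n + m) (d + e) (mmult L V U)"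
proof -
  obtain C D where CD: "circuit_ok L C" "gates_on L S (set (concat C))" "gate_count C \<le> n" "depth C \<le> d"
    "circuit_op L C = U" "circuit_ok L D" "gates_on L T (set (concat D))" "gate_count D \<le> m" "depth D \<le> e"
    "circuit_op L D = V"
    using assms by (auto simp: circuit_impl_def)
  moreover have "gates_on L (S \<union> T) (set (concat (C @ D)))"
    using CD unfolding gates_on_def concat_append set_append by blast
  ultimately show ?thesis
    unfolding circuit_impl_def
    by (intro exI[of _ "C @ D"])
      (auto simp: circuit_ok_def gate_count_def depth_def circuit_op_eq gates_op_append)
qed

text \<open>Over disjoint strips the gate counts add up, while the depth stays that of a single
  strip.\<close>

lemma evo_product_family_impl:
  assumes impl: "\<And>k ps. k < n \<Longrightarrow> distinct ps \<Longrightarrow> set ps = A k \<Longrightarrow> gates_impl L (S k) m (evo_product L H \<theta> ps)"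
    and fin: "\<And>k. k < n \<Longrightarrow> finite (A k)"
    and disj: "\<And>k l. k < l \<Longrightarrow> A k \<inter> A l = {}" "\<And>k l. k < l \<Longrightarrow> S k \<inter> S l = {}"
  shows "\<exists>ps. distinct ps \<and> set ps = (\<Union>k<n. A k)
    \<and> circuit_impl L (\<Union>k<n. S k) (n * m) m (evo_product L H \<theta> ps)"
  using impl fin
proof (induction n)
  case 0
  have "circuit_impl L {} 0 0 (ident L)"
    using gates_impl_circuit_impl[OF gates_impl_ident] .
  then have "circuit_impl L {} 0 m (ident L)" by (auto simp: circuit_impl_def)
  then show ?case by (intro exI[of _ "[]"]) (simp add: evo_product_def)
next
  case (Suc n)
  obtain ps where ps: "distinct ps" "set ps = (\<Union>k<n. A k)"
    "circuit_impl L (\<Union>k<n. S k) (n * m) m (evo_product L H \<theta> ps)"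
    using Suc by (metis less_SucI)
  obtain qs where qs: "set qs = A n" "distinct qs"
    using finite_distinct_list[OF Suc.prems(2)[of n]] by auto
  have "circuit_impl L (S n) m m (evo_product L H \<theta> qs)"
    using Suc.prems(1)[of n] qs by (intro gates_impl_circuit_impl) auto
  moreover have "(\<Union>k<n. S k) \<inter> S n = {}" using disj(2) by blast
  ultimately have "circuit_impl L ((\<Union>k<n. S k) \<union> S n) (n * m + m) m (evo_product L H \<theta> (ps @ qs))"
    unfolding evo_product_append by (intro circuit_impl_parallel ps)
  moreover have "(\<Union>k<n. A k) \<inter> A n = {}" using disj(1) by blast
  ultimately show ?case
    using ps qs by (intro exI[of _ "ps @ qs"]) (auto simp: lessThan_Suc Un_commute add.commute)
qed

subsection \<open>Covering all pairs by two families of strips\<close>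

text \<open>Truncated subtraction cuts the strip \<open>k = 0\<close> of the family with shift
  \<delta> down to the rows below \<delta>.\<close>

definition shifted_strip :: "nat \<Rightarrow> nat \<Rightarrow> nat \<Rightarrow> nat \<Rightarrow> site set" where
  "shifted_strip L \<delta> s k = strip L (2 * \<delta> * k - s) (2 * \<delta> * (k + 1) - s)"

lemma shifted_strip_disjoint:
  assumes "k < l"
  shows "shifted_strip L \<delta> s k \<inter> shifted_strip L \<delta> s l = {}"
proof -
  have "2 * \<delta> * (k + 1) \<le> 2 * \<delta> * l" using assms by (intro mult_le_mono2) simp
  then show ?thesis by (auto simp: shifted_strip_def strip_def)
qed

lemma finite_pairs: "finite (pairs L \<delta>)"
  by (rule finite_subset[of _ "Pow (sites L)"]) (auto simp: pairs_def)

lemma card_pairs_strip: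
  assumes "min L hi - lo \<le> r" "A \<subseteq> pairs L \<delta>" "\<And>p. p \<in> A \<Longrightarrow> p \<subseteq> strip L lo hi"
  shows "card A \<le> L * (r * (2 * \<delta> + 1) ^ 2)"
proof -
  let ?f = "\<lambda>(x, (u, v)). {x, (fst x + u - \<delta>, snd x + v - \<delta>)}"
  let ?D = "strip L lo hi \<times> ({0..2 * \<delta>} \<times> {0..2 * \<delta>})"
  have "A \<subseteq> ?f ` ?D"
  proof
    fix p assume p: "p \<in> A"
    then obtain x y where xy: "p = {x, y}" "linf_dist x y \<le> \<delta>"
      using assms(2) by (force simp: pairs_def)
    have "p = ?f (x, (fst y + \<delta> - fst x, snd y + \<delta> - snd x))"
      using xy by (cases x; cases y) (auto simp: linf_dist_def)
    moreover have "(x, (fst y + \<delta> - fst x, snd y + \<delta> - snd x)) \<in> ?D"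
      using xy assms(3)[OF p] by (auto simp: linf_dist_def)
    ultimately show "p \<in> ?f ` ?D" by (rule image_eqI)
  qed
  from surj_card_le[OF _ this] have "card A \<le> card ?D" by simp
  also have "\<dots> = (min L hi - lo) * L * (2 * \<delta> + 1) ^ 2"
    by (simp add: strip_def card_cartesian_product power2_eq_square)
  also have "\<dots> \<le> r * L * (2 * \<delta> + 1) ^ 2"
    using assms(1) by (intro mult_right_mono) auto
  finally show ?thesis by (simp add: mult_ac)
qed

lemma pair_in_shifted_strip:
  assumes "p \<in> pairs L \<delta>" "\<delta> \<ge> 1"
  obtains s k where "s = 0 \<or> s = \<delta>" "k < L + 1" "p \<subseteq> shifted_strip L \<delta> s k"
proof -
  obtain x y where xy: "p = {x, y}" "x \<in> sites L" "y \<in> sites L" "linf_dist x y \<le> \<delta>"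
    using assms(1) by (auto simp: pairs_def)
  define i where "i = min (fst x) (fst y)"
  have rows: "i \<le> fst x" "fst x \<le> i + \<delta>" "i \<le> fst y" "fst y \<le> i + \<delta>"
    using xy(4) by (auto simp: i_def linf_dist_def)
  define q e where "q = i div (2 * \<delta>)" and "e = i mod (2 * \<delta>)"
  have qe: "i = 2 * \<delta> * q + e" "e < 2 * \<delta>" using assms(2) by (auto simp: q_def e_def)
  have "i < L" using xy(2) by (auto simp: i_def sites_def)
  moreover have "q \<le> i" by (simp add: q_def)
  \<comment> \<open>The shifted case uses index \<open>q + 1\<close>, hence \<open>L + 1\<close>
    strips in each family, a crude bound that does not affect the order of growth.\<close>
  ultimately have q: "q + 1 < L + 1" by simp
  have mem: "p \<subseteq> strip L lo hi" if "lo \<le> i" "i + \<delta> < hi" for lo hi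
    using that rows xy by (auto simp: strip_def sites_def)
  show thesis
  proof (cases "e < \<delta>")
    case True
    have "p \<subseteq> shifted_strip L \<delta> 0 q"
      unfolding shifted_strip_def by (rule mem) (use True qe in \<open>simp_all add: algebra_simps\<close>)
    then show thesis using q by (intro that[of 0 q]) auto
  next
    case False
    have "p \<subseteq> shifted_strip L \<delta> \<delta> (q + 1)"
      unfolding shifted_strip_def by (rule mem) (use False qe in \<open>simp_all add: algebra_simps\<close>)
    then show thesis using q by (intro that[of \<delta> "q + 1"]) auto
  qed
qed

section \<open>Distributing the pairs over the two families and adding up the costs\<close>

theorem mainTheorem9:
  fixes \<delta> :: nat
  assumes "\<delta> \<ge> 1"
  shows "\<exists>K :: nat. \<forall>L :: nat. \<forall>(H :: site set \<Rightarrow> op) (\<theta> :: site set \<Rightarrow> real).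
    (\<forall>x y. {x, y} \<in> pairs L \<delta> \<longrightarrow> admissible_term L x y (H {x, y}))
    \<longrightarrow> (\<exists>m0 m1 ps C.
          canonical_ordering L m0 \<and> canonical_ordering L m1
        \<and> distinct ps \<and> set ps = pairs L \<delta>
        \<and> circuit_ok L C
        \<and> gate_count C \<le> K * (L * L) \<and> depth C \<le> K * L
        \<and> mmult L (circuit_op L C) (Phi L m0) = mmult L (Phi L m1) (evo_product L H \<theta> ps))"
proof -
  define r where "r = 2 * \<delta>"
  \<comment> \<open>The cost of a strip per column: two reorderings, and the evolutions of at most
    \<open>L * (r * (2 * \<delta> + 1) ^ 2)\<close> pairs.\<close>
  define W where "W = 4 * column_cost r + r * (2 * \<delta> + 1) ^ 2 * pair_cost r \<delta>"
  show ?thesis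
  \<comment> \<open>Each of the two families has \<open>L + 1\<close> strips of cost
    \<open>L * W\<close>, and \<open>(L + 1) * L\<close> is at most twice the number of sites. The
    depth alone would need only \<open>2 * W\<close>.\<close>
  proof (intro exI[of _ "4 * W"] allI impI)
    fix L :: nat and H :: "site set \<Rightarrow> op" and \<theta> :: "site set \<Rightarrow> real"
    assume adm: "\<forall>x y. {x, y} \<in> pairs L \<delta> \<longrightarrow> admissible_term L x y (H {x, y})"
    let ?St = "shifted_strip L \<delta>"
    have strip_impl: "gates_impl L (?St s k) (L * W) (evo_product L H \<theta> ps)"
      if ps: "distinct ps" "set ps \<subseteq> pairs L \<delta>" "\<And>p. p \<in> set ps \<Longrightarrow> p \<subseteq> ?St s k" for s k ps
    proof -
      let ?lo = "2 * \<delta> * k - s" and ?hi = "2 * \<delta> * (k + 1) - s"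
      have r: "min L ?hi - ?lo \<le> r" by (simp add: r_def)
      have "length ps = card (set ps)" using ps(1) by (simp add: distinct_card)
      also have "\<dots> \<le> L * (r * (2 * \<delta> + 1) ^ 2)"
        using card_pairs_strip[OF r ps(2)] ps(3) by (simp add: shifted_strip_def)
      finally have "4 * L * column_cost r + length ps * pair_cost r \<delta>
          \<le> 4 * L * column_cost r + L * (r * (2 * \<delta> + 1) ^ 2) * pair_cost r \<delta>"
        by (intro add_left_mono mult_right_mono) auto
      also have "\<dots> = L * W" by (simp add: W_def algebra_simps)
      finally show ?thesis
        unfolding shifted_strip_def
        using evo_product_strip_impl[OF r, where ps = ps and \<delta> = \<delta> and H = H and \<theta> = \<theta>] adm ps
        by (auto simp: shifted_strip_def intro: gates_impl_mono)
    qed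
    define A where "A k = {p \<in> pairs L \<delta>. p \<subseteq> ?St 0 k}" for k
    \<comment> \<open>A pair may fit into strips of both families; it is evolved in the first family
      only, so that it occurs once in the enumeration.\<close>
    define B where "B k = {p \<in> pairs L \<delta>. p \<subseteq> ?St \<delta> k} - (\<Union>l<L + 1. A l)" for k
    \<comment> \<open>A pair is nonempty and thus cannot lie in two disjoint strips.\<close>
    have disjoint: "{p \<in> pairs L \<delta>. p \<subseteq> ?St s k} \<inter> {p \<in> pairs L \<delta>. p \<subseteq> ?St s l} = {}" if "k < l" for s k l
      using shifted_strip_disjoint[OF that, of L \<delta> s] by (auto simp: pairs_def)
    obtain ps where ps: "distinct ps" "set ps = (\<Union>k<L + 1. A k)"
      "circuit_impl L (\<Union>k<L + 1. ?St 0 k) ((L + 1) * (L * W)) (L * W) (evo_product L H \<theta> ps)"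
    proof -
      have "\<exists>ps. distinct ps \<and> set ps = (\<Union>k<L + 1. A k) \<and>
        circuit_impl L (\<Union>k<L + 1. ?St 0 k) ((L + 1) * (L * W)) (L * W) (evo_product L H \<theta> ps)"
      proof (rule evo_product_family_impl)
        show "gates_impl L (?St 0 k) (L * W) (evo_product L H \<theta> ps)" if "distinct ps" "set ps = A k" for k ps
          by (rule strip_impl) (use that in \<open>auto simp: A_def\<close>)
        show "finite (A k)" for k using finite_pairs by (simp add: A_def)
        show "A k \<inter> A l = {}" if "k < l" for k l using disjoint[OF that, of 0] by (simp add: A_def)
      qed (rule shifted_strip_disjoint)
      then show thesis using that by blast
    qed
    obtain qs where qs: "distinct qs" "set qs = (\<Union>k<L + 1. B k)"
      "circuit_impl L (\<Union>k<L + 1. ?St \<delta> k) ((L + 1) * (L * W)) (L * W) (evo_product L H \<theta> qs)"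
    proof -
      have "\<exists>qs. distinct qs \<and> set qs = (\<Union>k<L + 1. B k) \<and>
        circuit_impl L (\<Union>k<L + 1. ?St \<delta> k) ((L + 1) * (L * W)) (L * W) (evo_product L H \<theta> qs)"
      proof (rule evo_product_family_impl)
        show "gates_impl L (?St \<delta> k) (L * W) (evo_product L H \<theta> qs)" if "distinct qs" "set qs = B k" for k qs
          by (rule strip_impl) (use that in \<open>auto simp: B_def\<close>)
        show "finite (B k)" for k using finite_pairs by (simp add: B_def)
        show "B k \<inter> B l = {}" if "k < l" for k l using disjoint[OF that, of \<delta>] by (auto simp: B_def)
      qed (rule shifted_strip_disjoint)
      then show thesis using that by blast
    qed
    obtain C where C: "circuit_ok L C" "gate_count C \<le> (L + 1) * (L * W) + (L + 1) * (L * W)"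
      "depth C \<le> L * W + L * W" "circuit_op L C = evo_product L H \<theta> (ps @ qs)"
      using circuit_impl_sequential[OF ps(3) qs(3)] by (auto simp: circuit_impl_def evo_product_append)
    have "(L + 1) * L \<le> 2 * (L * L)" by (cases L) auto
    then have "(L + 1) * L * W \<le> 2 * (L * L) * W" by (rule mult_right_mono) simp
    then have "2 * ((L + 1) * L * W) \<le> 4 * W * (L * L)" by simp
    with C(2) have count: "gate_count C \<le> 4 * W * (L * L)"
      by (simp only: mult_2 mult.assoc)
    have depth: "depth C \<le> 4 * W * L"
      using C(3) by (rule le_trans) (simp add: mult.commute)
    have "set (ps @ qs) = pairs L \<delta>"
    proof (intro equalityI subsetI)
      fix p assume p: "p \<in> pairs L \<delta>"
      obtain s k where "s = 0 \<or> s = \<delta>" "k < L + 1" "p \<subseteq> ?St s k"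
        using pair_in_shifted_strip[OF p assms] .
      then show "p \<in> set (ps @ qs)"
        using p by (auto simp: ps qs A_def B_def)
    qed (auto simp: ps qs A_def B_def)
    moreover have "distinct (ps @ qs)" using ps(1,2) qs(1,2) by (auto simp: B_def)
    ultimately show "\<exists>m0 m1 ps C. canonical_ordering L m0 \<and> canonical_ordering L m1
        \<and> distinct ps \<and> set ps = pairs L \<delta> \<and> circuit_ok L C
        \<and> gate_count C \<le> 4 * W * (L * L) \<and> depth C \<le> 4 * W * L
        \<and> mmult L (circuit_op L C) (Phi L m0) = mmult L (Phi L m1) (evo_product L H \<theta> ps)"
      using C(1,4) count depth
      by (intro exI[of _ "ref_ord L"] exI[of _ "ps @ qs"] exI[of _ C])
        (auto simp: Phi_ref_ord canonical_ordering_ref_ord)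
  qed
qed

end
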